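(* Let $m,r,s$ be positive integers with $m>3$ and $r\not\equiv 0\pmod{2m}$. If the graph $\Gamma=\Gamma_{12}(m,r,s)$ is connected and vertex-transitive, then $m$ is odd and $\Gamma\cong\mathrm{SDW}(m,3)$. Conversely, if $m$ is odd, then $\mathrm{SDW}(m,3)$ is isomorphic to $\Gamma_{12}(m,1,2)$, is connected and vertex-transitive, and admits an automorphism of order $2m$.
   Context: For a positive integer $m$ and integers $r,s$ with $r\not\equiv0\pmod{2m}$, $\Gamma_{12}(m,r,s)$ is the graph on $6m$ vertices with vertex set $\{u_i,v_i: i\in\mathbb{Z}_{2m}\}\cup\{a_i,b_i: i\in\mathbb{Z}_m\}$ and edges $\{u_i,v_i\}$, $\{u_i,v_{i+r}\}$, $\{u_i,a_{i\bmod m}\}$, $\{v_i,b_{i\bmod m}\}$ for $i\in\mathbb{Z}_{2m}$, and $\{a_i,b_{i+s}\}$ for $i\in\mathbb{Z}_m$. For $m,t\ge3$, $\mathrm{SDW}(m,t)$ is the graph with vertex set $\mathbb{Z}_m\times\mathbb{Z}_t\times\mathbb{Z}_2$ and edges $\{(x,i,0),(x,i\pm1,1)\}$ and $\{(x,i,1),(x+1,i,0)\}$ for $x\in\mathbb{Z}_m$, $i\in\mathbb{Z}_t$. *)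

theory Defs
  imports "HOL-Number_Theory.Cong" "HOL-Algebra.Bij" "HOL-Algebra.Multiplicative_Group" "Graph_Theory.Graph_Theory"
begin

text \<open>
  A simple graph is a \<^locale>\<open>pair_graph\<close>, that is, a finite loop-free symmetric digraph on pairs.
  The functions below list undirected edges as sets \<open>{u, v}\<close>; \<open>graph_of\<close> replaces each such set by
  the two arcs \<open>(u, v)\<close> and \<open>(v, u)\<close>.
\<close>

definition graph_of :: "'a set \<Rightarrow> 'a set set \<Rightarrow> 'a pair_pre_digraph" where
  "graph_of V E = \<lparr> pverts = V, parcs = {(u, v). {u, v} \<in> E} \<rparr>"

text \<open>
  Automorphisms are extensional functions on the vertex set (as in \<^const>\<open>Bij\<close>), so that distinct
  elements of the group differ on some vertex and the order of an element is its order as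
  a permutation of the vertices.
\<close>

definition Aut :: "'a pair_pre_digraph \<Rightarrow> ('a \<Rightarrow> 'a) monoid" where
  "Aut G = (BijGroup (pverts G))
     \<lparr> carrier := {f \<in> Bij (pverts G).
         \<forall>u \<in> pverts G. \<forall>v \<in> pverts G. (u, v) \<in> parcs G \<longleftrightarrow> (f u, f v) \<in> parcs G} \<rparr>"

definition vertex_transitive :: "'a pair_pre_digraph \<Rightarrow> bool" where
  "vertex_transitive G \<longleftrightarrow>
     (\<forall>u \<in> pverts G. \<forall>v \<in> pverts G. \<exists>f \<in> carrier (Aut G). f u = v)"

lemma Aut_subgroup: "subgroup (carrier (Aut G)) (BijGroup (pverts G))"
proof (rule group.subgroupI[OF group_BijGroup])
  let ?V = "pverts G"
  show "carrier (Aut G) \<subseteq> carrier (BijGroup ?V)"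
    by (auto simp: Aut_def BijGroup_def)
  have "(\<lambda>x\<in>?V. x) \<in> carrier (Aut G)"
    by (simp add: Aut_def id_Bij)
  then show "carrier (Aut G) \<noteq> {}" by blast
next
  fix f assume "f \<in> carrier (Aut G)"
  then have f: "f \<in> Bij (pverts G)"
    and e: "\<And>u v. u \<in> pverts G \<Longrightarrow> v \<in> pverts G \<Longrightarrow>
              (u, v) \<in> parcs G \<longleftrightarrow> (f u, f v) \<in> parcs G"
    by (auto simp: Aut_def)
  have b: "bij_betw f (pverts G) (pverts G)" using f by (simp add: Bij_def)
  have "f (inv_into (pverts G) f u) = u" if "u \<in> pverts G" for u
    using b that by (metis bij_betw_inv_into_right)
  moreover have "inv_into (pverts G) f u \<in> pverts G" if "u \<in> pverts G" for u
    using Bij_inv_into_mem[OF f that] .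
  ultimately show "inv\<^bsub>BijGroup (pverts G)\<^esub> f \<in> carrier (Aut G)"
    using e f by (simp add: inv_BijGroup Aut_def restrict_inv_into_Bij)
next
  fix f g assume "f \<in> carrier (Aut G)" "g \<in> carrier (Aut G)"
  then have f: "f \<in> Bij (pverts G)" and g: "g \<in> Bij (pverts G)"
    and ef: "\<And>u v. u \<in> pverts G \<Longrightarrow> v \<in> pverts G \<Longrightarrow>
              (f u, f v) \<in> parcs G \<longleftrightarrow> (u, v) \<in> parcs G"
    and eg: "\<And>u v. u \<in> pverts G \<Longrightarrow> v \<in> pverts G \<Longrightarrow>
              (g u, g v) \<in> parcs G \<longleftrightarrow> (u, v) \<in> parcs G"
    by (auto simp: Aut_def)
  have "g u \<in> pverts G" if "u \<in> pverts G" for u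
    using Bij_imp_funcset[OF g] that by auto
  then show "f \<otimes>\<^bsub>BijGroup (pverts G)\<^esub> g \<in> carrier (Aut G)"
    using f g ef eg by (simp add: Aut_def BijGroup_def compose_Bij compose_eq)
qed

lemma group_Aut: "group (Aut G)"
proof -
  have "Aut G = (BijGroup (pverts G)) \<lparr> carrier := carrier (Aut G) \<rparr>"
    by (simp add: Aut_def)
  then show ?thesis
    using group.subgroup_imp_group[OF group_BijGroup Aut_subgroup] by metis
qed

lemma pair_graph_graph_of:
  assumes "finite V" "\<And>e. e \<in> E \<Longrightarrow> e \<subseteq> V" "\<And>v. {v} \<notin> E"
  shows "pair_graph (graph_of V E)"
proof
  show "finite (parcs (graph_of V E))"
    by (rule finite_subset[of _ "V \<times> V"]) (use assms in \<open>auto simp: graph_of_def\<close>)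
  show "symmetric (with_proj (graph_of V E))"
    by (auto simp: symmetric_def graph_of_def sym_def insert_commute)
qed (use assms in \<open>fastforce simp: graph_of_def\<close>)+

text \<open>
  Residues modulo \<open>n\<close> are represented by the integers in \<open>{0..<n}\<close>.
\<close>

datatype gamma_vertex = U int | V int | A int | B int

definition Gamma12 :: "int \<Rightarrow> int \<Rightarrow> int \<Rightarrow> gamma_vertex pair_pre_digraph" where
  "Gamma12 m r s = graph_of
     (U ` {0..<2 * m} \<union> V ` {0..<2 * m} \<union> A ` {0..<m} \<union> B ` {0..<m})
     ({{U i, V i} | i. i \<in> {0..<2 * m}} \<union>
      {{U i, V ((i + r) mod (2 * m))} | i. i \<in> {0..<2 * m}} \<union>
      {{U i, A (i mod m)} | i. i \<in> {0..<2 * m}} \<union>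
      {{V i, B (i mod m)} | i. i \<in> {0..<2 * m}} \<union>
      {{A i, B ((i + s) mod m)} | i. i \<in> {0..<m}})"

definition SDW :: "int \<Rightarrow> int \<Rightarrow> (int \<times> int \<times> int) pair_pre_digraph" where
  "SDW m t = graph_of
     ({0..<m} \<times> {0..<t} \<times> {0..<2})
     ({{(x, i, 0), (x, (i + 1) mod t, 1)} | x i. x \<in> {0..<m} \<and> i \<in> {0..<t}} \<union>
      {{(x, i, 0), (x, (i - 1) mod t, 1)} | x i. x \<in> {0..<m} \<and> i \<in> {0..<t}} \<union>
      {{(x, i, 1), ((x + 1) mod m, i, 0)} | x i. x \<in> {0..<m} \<and> i \<in> {0..<t}})"

lemma pair_graph_Gamma12:
  assumes "m > 0"
  shows "pair_graph (Gamma12 m r s)"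
  unfolding Gamma12_def
  by (rule pair_graph_graph_of) (use assms in \<open>auto simp: image_iff doubleton_eq_iff\<close>)

lemma pair_graph_SDW:
  assumes "m > 0" "t > 0"
  shows "pair_graph (SDW m t)"
  unfolding SDW_def
  by (rule pair_graph_graph_of) (use assms in \<open>auto simp: doubleton_eq_iff\<close>)

end

theory Submission
  imports Defs
begin

text \<open>
  All edges at \<open>u\<^sub>0\<close> lie on 6-cycles, so by vertex transitivity \<open>a\<^sub>0 b\<^sub>s\<close> does too; this forces
  \<open>s \<equiv> 2r\<close> or \<open>s \<equiv> -r\<close> modulo \<open>m\<close>. Indices modulo \<open>gcd r m\<close> are then constant along edges, so
  connectedness gives \<open>gcd r m = 1\<close>. The case \<open>s \<equiv> -r\<close> becomes the case \<open>s \<equiv> 2r\<close> after replacing \<open>r\<close>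
  by \<open>-r\<close> and shifting the indices of \<open>v\<close> and \<open>b\<close>.

  Let \<open>s \<equiv> 2r\<close>. The perfect matching of the edges \<open>u\<^sub>i v\<^sub>i\<close> and \<open>a\<^sub>i b\<^bsub>i+s\<^esub>\<close> is invariant under automorphisms:
  an edge \<open>xy\<close> belongs to it exactly when \<open>x\<close> and its two neighbours other than \<open>y\<close> lie on two 6-cycles in
  which the vertices opposite to \<open>x\<close> differ. The remaining edges form disjoint hexagons. Following the
  matching and then passing to the opposite vertex of a hexagon is a permutation that commutes with every
  automorphism; it maps \<open>a\<^sub>i\<close> to \<open>a\<^bsub>i+r\<^esub>\<close> and \<open>u\<^sub>i\<close> to \<open>u\<^bsub>i-r+m\<^esub>\<close>. Its \<open>m\<close>-th power fixes \<open>a\<^sub>0\<close>, so it must fix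
  \<open>u\<^sub>0\<close> as well, which means that \<open>m - r\<close> is even; hence \<open>m\<close> and \<open>r\<close> are odd. In that case the necklace of
  hexagons closes up without a twist and is \<open>SDW m 3\<close>.
\<close>

section \<open>Six-cycles and matchings\<close>

definition opposite :: "('a \<Rightarrow> 'a \<Rightarrow> bool) \<Rightarrow> 'a \<Rightarrow> 'a \<Rightarrow> 'a \<Rightarrow> 'a \<Rightarrow> bool" where
  "opposite E p x q w \<longleftrightarrow>
     (\<exists>y z. E p y \<and> E y w \<and> E q z \<and> E z w \<and> distinct [x, p, y, w, z, q])"

text \<open>
  \<open>opposite E p x q w\<close>: some 6-cycle contains the path \<open>p x q\<close> and has \<open>w\<close> opposite to \<open>x\<close>. In the
  graphs below the heavy edges are the perfect matching, and the light ones form the hexagons.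
\<close>

definition heavy :: "('a \<Rightarrow> 'a \<Rightarrow> bool) \<Rightarrow> 'a \<Rightarrow> 'a \<Rightarrow> bool" where
  "heavy E x y \<longleftrightarrow> E x y \<and>
     (\<exists>p q w w'. E x p \<and> E x q \<and> distinct [y, p, q] \<and> w \<noteq> w' \<and>
        opposite E p x q w \<and> opposite E p x q w')"

definition light :: "('a \<Rightarrow> 'a \<Rightarrow> bool) \<Rightarrow> 'a \<Rightarrow> 'a \<Rightarrow> bool" where
  "light E x y \<longleftrightarrow> E x y \<and> \<not> heavy E x y"

text \<open>The conditions \<open>q \<noteq> y\<close> and \<open>w \<noteq> p\<close> forbid
  backtracking, so that in a hexagon of light edges \<open>w\<close> is antipodal to
  \<open>y\<close>, the matching partner of \<open>x\<close>.\<close>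

definition across :: "('a \<Rightarrow> 'a \<Rightarrow> bool) \<Rightarrow> 'a \<Rightarrow> 'a \<Rightarrow> bool" where
  "across E x w \<longleftrightarrow>
     (\<exists>y p q. heavy E x y \<and> light E y p \<and> light E p q \<and> light E q w \<and> q \<noteq> y \<and> w \<noteq> p)"

lemma opposite_commute: "opposite E p x q w \<longleftrightarrow> opposite E q x p w"
  unfolding opposite_def by auto

text \<open>Injectivity keeps the six vertices distinct, and closure of \<open>S\<close> under
  adjacency keeps the whole cycle inside \<open>S\<close>.\<close>

lemma opposite_image:
  assumes inj: "inj_on f S"
    and edge: "\<And>x y. x \<in> S \<Longrightarrow> E x y \<Longrightarrow> y \<in> S \<and> E' (f x) (f y)"
    and pxq: "p \<in> S" "x \<in> S" "q \<in> S" and opp: "opposite E p x q w"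
  shows "opposite E' (f p) (f x) (f q) (f w) \<and> w \<in> S"
proof -
  obtain y z where *: "E p y" "E y w" "E q z" "E z w" "distinct [x, p, y, w, z, q]"
    using opp unfolding opposite_def by blast
  have y: "y \<in> S" "E' (f p) (f y)" using edge[OF pxq(1) *(1)] by auto
  have z: "z \<in> S" "E' (f q) (f z)" using edge[OF pxq(3) *(3)] by auto
  have w: "w \<in> S" "E' (f y) (f w)" "E' (f z) (f w)"
    using edge[OF y(1) *(2)] edge[OF z(1) *(4)] by auto
  have "set [x, p, y, w, z, q] \<subseteq> S" using pxq y z w by simp
  with inj have "inj_on f (set [x, p, y, w, z, q])" by (rule inj_on_subset)
  with *(5) have "distinct (map f [x, p, y, w, z, q])"
    unfolding distinct_map by blast
  then show ?thesis
    unfolding opposite_def using y z w by auto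
qed

lemma heavyI:
  assumes "E x y" "E x p" "E x q" "distinct [y, p, q]" "w \<noteq> w'"
    and "opposite E p x q w" "opposite E p x q w'"
  shows "heavy E x y"
  using assms unfolding heavy_def by blast

section \<open>Necklaces of hexagons\<close>

text \<open>
  In \<open>Gamma12 m r (2 * r)\<close>, \<open>u k l\<close> is the vertex \<open>u\<close> with index \<open>k * r + l * m\<close>, and \<open>a k\<close> is the vertex \<open>a\<close>
  with index \<open>k * r\<close>. In these coordinates adjacency depends neither on \<open>m\<close> nor on \<open>r\<close>, and vertices
  whose first coordinates differ by at most 3 are equal only if they obviously are.
\<close>

locale hexagon_necklace =
  fixes E :: "'a \<Rightarrow> 'a \<Rightarrow> bool" and u v :: "int \<Rightarrow> int \<Rightarrow> 'a" and a b :: "int \<Rightarrow> 'a"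
    and m r :: int
  assumes m_gt_3: "m > 3" and coprime_r_m: "coprime r m"
    and u_eq: "u k l = u k' l' \<longleftrightarrow> 2 * m dvd (k - k') * r + (l - l') * m"
    and v_eq: "v k l = v k' l' \<longleftrightarrow> 2 * m dvd (k - k') * r + (l - l') * m"
    and a_eq: "a k = a k' \<longleftrightarrow> m dvd k - k'"
    and b_eq: "b k = b k' \<longleftrightarrow> m dvd k - k'"
    and neqs [simp]: "u k l \<noteq> v k' l'" "u k l \<noteq> a k'" "u k l \<noteq> b k'"
      "v k l \<noteq> a k'" "v k l \<noteq> b k'" "a k \<noteq> b k'"
    and E_u: "E (u k l) y \<longleftrightarrow> y = v k l \<or> y = v (k + 1) l \<or> y = a k"
    and E_v: "E (v k l) y \<longleftrightarrow> y = u k l \<or> y = u (k - 1) l \<or> y = b k"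
    and E_a: "E (a k) y \<longleftrightarrow> y = u k 0 \<or> y = u k 1 \<or> y = b (k + 2)"
    and E_b: "E (b k) y \<longleftrightarrow> y = v k 0 \<or> y = v k 1 \<or> y = a (k - 2)"
begin

lemmas neqs_sym [simp] = neqs [symmetric]

text \<open>The symmetry that swaps \<open>u\<close> with \<open>v\<close> and \<open>a\<close> with
  \<open>b\<close> and negates first coordinates. Through it, facts about \<open>u\<close> and
  \<open>a\<close> yield those about \<open>v\<close> and \<open>b\<close>.\<close>

lemma reversed: "hexagon_necklace E (\<lambda>k. v (- k)) (\<lambda>k. u (- k)) (\<lambda>k. b (- k)) (\<lambda>k. a (- k)) m (- r)"
proof
  fix k l k' l' :: int
  have "(- k - - k') * r + (l - l') * m = (k - k') * (- r) + (l - l') * m" by (simp add: algebra_simps)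
  then show "v (- k) l = v (- k') l' \<longleftrightarrow> 2 * m dvd (k - k') * (- r) + (l - l') * m"
    and "u (- k) l = u (- k') l' \<longleftrightarrow> 2 * m dvd (k - k') * (- r) + (l - l') * m"
    by (simp_all only: u_eq v_eq)
  show "b (- k) = b (- k') \<longleftrightarrow> m dvd k - k'" "a (- k) = a (- k') \<longleftrightarrow> m dvd k - k'"
    unfolding a_eq b_eq by (simp_all add: dvd_diff_commute)
qed (use m_gt_3 coprime_r_m in \<open>auto simp: E_u E_v E_a E_b\<close>)

lemma small_multiple: "k = 0" if "m dvd k" "\<bar>k\<bar> \<le> 3" for k
  using that m_gt_3 dvd_imp_le_int[of k m] by (cases "k = 0") simp_all

text \<open>Modulo \<open>m\<close> the second summand vanishes and coprimality gives
  \<open>m dvd k - k'\<close>. As \<open>m > 3\<close>, this forces \<open>k = k'\<close>, and only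
  the parity of \<open>l - l'\<close> remains.\<close>

lemma twisted_eq_near:
  assumes "\<bar>k - k'\<bar> \<le> 3"
  shows "2 * m dvd (k - k') * r + (l - l') * m \<longleftrightarrow> k = k' \<and> even (l - l')"
proof
  assume *: "2 * m dvd (k - k') * r + (l - l') * m"
  then have "m dvd (k - k') * r + (l - l') * m" using dvd_mult_right by blast
  then have "m dvd (k - k') * r" by (simp add: dvd_add_left_iff)
  then have "m dvd k - k'"
    using coprime_r_m by (simp add: coprime_commute coprime_dvd_mult_left_iff)
  with small_multiple[OF this assms] have "k = k'" by simp
  with * m_gt_3 show "k = k' \<and> even (l - l')" by simp
qed (use m_gt_3 in auto)

lemma near [simp]:
  assumes "\<bar>k - k'\<bar> \<le> 3"
  shows "u k l = u k' l' \<longleftrightarrow> k = k' \<and> even (l - l')"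
    "v k l = v k' l' \<longleftrightarrow> k = k' \<and> even (l - l')"
    "a k = a k' \<longleftrightarrow> k = k'" "b k = b k' \<longleftrightarrow> k = k'"
  using twisted_eq_near[OF assms] small_multiple[OF _ assms]
  by (auto simp: u_eq v_eq a_eq b_eq)

section \<open>Recognising the matching by 6-cycles\<close>

lemmas E_simps = E_u E_v E_a E_b

text \<open>These are the two pairs of neighbours of \<open>u k l\<close> that contain its matching
  partner \<open>v k l\<close>. Comparing the paths of length two from both ends leaves a single
  possible opposite vertex.\<close>

lemma opposite_u:
  "opposite E (v k l) (u k l) (a k) w \<Longrightarrow> w = v k (l + 1)"
  "opposite E (v (k + 1) l) (u k l) (v k l) w \<Longrightarrow> w = a (k - 1)"
  unfolding opposite_def by (auto simp: E_simps)

lemma opposite_a: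
  "opposite E (u k l) (a k) (b (k + 2)) w \<Longrightarrow> w = u (k + 1) l"
  unfolding opposite_def by (auto simp: E_simps)

lemma heavy_u: "heavy E (u k l) y \<longleftrightarrow> y = v k l"
proof
  assume "heavy E (u k l) y"
  then obtain p q w w' where *: "E (u k l) y" "E (u k l) p" "E (u k l) q" "distinct [y, p, q]"
      "w \<noteq> w'" "opposite E p (u k l) q w" "opposite E p (u k l) q w'"
    unfolding heavy_def by blast
  show "y = v k l"
  proof (rule ccontr)
    assume "y \<noteq> v k l"
    with *(1-4) consider "p = v k l \<and> q = a k" | "q = v k l \<and> p = a k"
      | "p = v k l \<and> q = v (k + 1) l" | "q = v k l \<and> p = v (k + 1) l"
      unfolding E_u by (elim disjE) simp_all
    then show False
      using *(5-7) by cases (auto dest!: opposite_u opposite_u[OF opposite_commute[THEN iffD1]])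
  qed
next
  \<comment> \<open>The two light neighbours lie on two 6-cycles with \<open>u k l\<close>: here one
    that crosses into the next hexagon along two heavy edges, and in \<open>2\<close> the light
    hexagon itself.\<close>
  have 1: "opposite E (a k) (u k l) (v (k + 1) l) (v (k + 2) l)"
    unfolding opposite_def
    by (rule exI[of _ "b (k + 2)"], rule exI[of _ "u (k + 1) l"]) (simp add: E_simps)
  have 2: "opposite E (a k) (u k l) (v (k + 1) l) (v (k + 1) (l + 1))"
    unfolding opposite_def
    by (rule exI[of _ "u k (l + 1)"], rule exI[of _ "b (k + 1)"]) (cases "even l"; simp add: E_simps)
  show "heavy E (u k l) y" if "y = v k l"
    unfolding that by (intro heavyI[OF _ _ _ _ _ 1 2]) (simp_all add: E_u)
qed

lemma heavy_a: "heavy E (a k) y \<longleftrightarrow> y = b (k + 2)"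
proof
  assume "heavy E (a k) y"
  then obtain p q w w' where *: "E (a k) y" "E (a k) p" "E (a k) q" "distinct [y, p, q]"
      "w \<noteq> w'" "opposite E p (a k) q w" "opposite E p (a k) q w'"
    unfolding heavy_def by blast
  show "y = b (k + 2)"
  proof (rule ccontr)
    assume "y \<noteq> b (k + 2)"
    with *(1-4) consider "p = b (k + 2) \<and> q = u k 0" | "p = b (k + 2) \<and> q = u k 1"
      | "q = b (k + 2) \<and> p = u k 0" | "q = b (k + 2) \<and> p = u k 1"
      unfolding E_a by (elim disjE) simp_all
    then show False
      using *(5-7) by cases (auto dest!: opposite_a opposite_a[OF opposite_commute[THEN iffD1]])
  qed
next
  \<comment> \<open>This cycle crosses into the previous hexagon along two heavy edges; the one in
    \<open>2\<close> is the light hexagon.\<close>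
  have 1: "opposite E (u k 0) (a k) (u k 1) (b k)"
    unfolding opposite_def
    by (rule exI[of _ "v k 0"], rule exI[of _ "v k 1"]) (simp add: E_simps)
  have 2: "opposite E (u k 0) (a k) (u k 1) (b (k + 1))"
    unfolding opposite_def
    by (rule exI[of _ "v (k + 1) 0"], rule exI[of _ "v (k + 1) 1"]) (simp add: E_simps)
  show "heavy E (a k) y" if "y = b (k + 2)"
    unfolding that by (intro heavyI[OF _ _ _ _ _ 1 2]) (simp_all add: E_a)
qed


lemma heavy_v: "heavy E (v k l) y \<longleftrightarrow> y = u k l"
  using hexagon_necklace.heavy_u[OF reversed, of "- k" l y] by simp

lemma heavy_b: "heavy E (b k) y \<longleftrightarrow> y = a (k - 2)"
  using hexagon_necklace.heavy_a[OF reversed, of "- k" y] by simp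

lemmas heavy_simps = heavy_u heavy_v heavy_a heavy_b

lemma light_simps:
  "light E (u k l) y \<longleftrightarrow> y = v (k + 1) l \<or> y = a k"
  "light E (v k l) y \<longleftrightarrow> y = u (k - 1) l \<or> y = b k"
  "light E (a k) y \<longleftrightarrow> y = u k 0 \<or> y = u k 1"
  "light E (b k) y \<longleftrightarrow> y = v k 0 \<or> y = v k 1"
  unfolding light_def by (auto simp: E_simps heavy_simps)

text \<open>The partner \<open>b (k + 2)\<close> of \<open>a k\<close> is antipodal to
  \<open>a (k + 1)\<close> in the next hexagon, so \<open>a\<close> moves forward, whereas in
  \<open>across_u\<close> the vertex \<open>u\<close> moves backward and changes parity. A map
  taking \<open>a 0\<close> to \<open>u 0 0\<close> calls for existence at \<open>a\<close> and
  uniqueness at \<open>u\<close>.\<close>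

lemma across_a: "across E (a k) (a (k + 1))"
  unfolding across_def
  by (intro exI[of _ "b (k + 2)"] exI[of _ "v (k + 2) 0"] exI[of _ "u (k + 1) 0"])
    (simp add: heavy_simps light_simps)

lemma across_u: "across E (u k l) w \<Longrightarrow> w = u (k - 1) (l + 1)"
  unfolding across_def by (auto simp: heavy_simps light_simps)

definition vertices :: "'a set" where
  "vertices = range (case_prod u) \<union> range (case_prod v) \<union> range a \<union> range b"

lemma verticesE [consumes 1, case_names u v a b]:
  assumes "x \<in> vertices"
  obtains k l where "x = u k l" | k l where "x = v k l" | k where "x = a k" | k where "x = b k"
  using assms unfolding vertices_def by auto

lemma ex1_heavy: "x \<in> vertices \<Longrightarrow> \<exists>!y. heavy E x y"
  by (cases x rule: verticesE) (auto simp: heavy_simps)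

lemma E_vertices:
  assumes "E x y" "x \<in> vertices"
  shows "y \<in> vertices"
  using assms(2,1) by (cases x rule: verticesE) (auto simp: E_simps vertices_def)

end

section \<open>Injective edge-preserving maps of a necklace\<close>

locale necklace_endo = hexagon_necklace +
  fixes f :: "'a \<Rightarrow> 'a"
  assumes inj: "inj_on f vertices" and maps: "x \<in> vertices \<Longrightarrow> f x \<in> vertices"
    and edge: "x \<in> vertices \<Longrightarrow> E x y \<Longrightarrow> E (f x) (f y)"
begin

lemma heavy_image:
  assumes "x \<in> vertices" "heavy E x y"
  shows "heavy E (f x) (f y)"
proof -
  have opp: "opposite E (f p) (f x) (f q) (f w) \<and> w \<in> vertices"
    if "opposite E p x q w" "p \<in> vertices" "q \<in> vertices" for p q w
    using opposite_image[OF inj, of E E] that assms(1) E_vertices edge by blast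
  obtain p q w w' where *: "E x y" "E x p" "E x q" "distinct [y, p, q]" "w \<noteq> w'"
      "opposite E p x q w" "opposite E p x q w'"
    using assms(2) unfolding heavy_def by blast
  have S: "y \<in> vertices" "p \<in> vertices" "q \<in> vertices"
    using *(1-3)[THEN E_vertices] assms(1) by blast+
  show ?thesis
  proof (rule heavyI)
    show "E (f x) (f y)" "E (f x) (f p)" "E (f x) (f q)" using edge[OF assms(1)] *(1-3) by blast+
    show "opposite E (f p) (f x) (f q) (f w)" "opposite E (f p) (f x) (f q) (f w')"
      using opp[OF *(6)] opp[OF *(7)] S by blast+
    show "f w \<noteq> f w'"
      using opp[OF *(6)] opp[OF *(7)] S *(5) inj_on_eq_iff[OF inj] by blast
    show "distinct [f y, f p, f q]"
      using *(4) S inj_on_eq_iff[OF inj] by auto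
  qed
qed

text \<open>The image of the matching partner \<open>y'\<close> is already the only heavy neighbour
  of \<open>f x\<close>, and injectivity keeps \<open>f y\<close> different from it.\<close>

lemma light_image:
  assumes x: "x \<in> vertices" and "light E x y"
  shows "light E (f x) (f y)"
proof -
  obtain y' where y': "heavy E x y'" using ex1_heavy[OF x] by blast
  have y: "E x y" "\<not> heavy E x y" using assms(2) unfolding light_def by auto
  have "y \<in> vertices" "y' \<in> vertices" "y \<noteq> y'"
    using y y' E_vertices[OF _ x] unfolding heavy_def by blast+
  then have "f y \<noteq> f y'" using inj_on_eq_iff[OF inj] by blast
  with heavy_image[OF x y'] ex1_heavy[OF maps[OF x]] have "\<not> heavy E (f x) (f y)" by blast
  then show ?thesis using edge x y unfolding light_def by blast
qed

lemma across_image: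
  assumes x: "x \<in> vertices" and "across E x w"
  shows "across E (f x) (f w)"
proof -
  obtain y p q where *: "heavy E x y" "light E y p" "light E p q" "light E q w" "q \<noteq> y" "w \<noteq> p"
    using assms(2) unfolding across_def by blast
  then have E: "E x y" "E y p" "E p q" "E q w" unfolding heavy_def light_def by blast+
  have y: "y \<in> vertices" using E_vertices[OF E(1) x] .
  have p: "p \<in> vertices" using E_vertices[OF E(2) y] .
  have q: "q \<in> vertices" using E_vertices[OF E(3) p] .
  have w: "w \<in> vertices" using E_vertices[OF E(4) q] .
  have "f q \<noteq> f y" "f w \<noteq> f p"
    using *(5,6) y p q w inj_on_eq_iff[OF inj] by auto
  then show ?thesis
    unfolding across_def
    using heavy_image[OF x *(1)] light_image[OF y *(2)] light_image[OF p *(3)]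
      light_image[OF q *(4)] by blast
qed

text \<open>After \<open>m\<close> steps of \<open>across\<close>, \<open>a 0\<close> returns to
  itself while its image has moved to \<open>u (- m) m\<close>. Equality with \<open>u 0 0\<close>
  makes \<open>m - r\<close> even, and coprimality excludes that both are even.\<close>

lemma odd_if_maps_a_to_u:
  assumes "f (a 0) = u 0 0"
  shows "odd m \<and> odd r"
proof -
  have "f (a (int n)) = u (- int n) (int n)" for n
  proof (induction n)
    case (Suc n)
    have "a (int n) \<in> vertices" by (simp add: vertices_def)
    from across_u[OF across_image[OF this across_a, unfolded Suc]] show ?case
      by (simp add: algebra_simps)
  qed (simp add: assms)
  from this[of "nat m"] have "f (a m) = u (- m) m" using m_gt_3 by simp
  moreover have "a m = a 0" by (simp add: a_eq)
  ultimately have "u (- m) m = u 0 0" using assms by simp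
  then have "2 * m dvd (m - r) * m" by (simp add: u_eq algebra_simps)
  then have "even (m - r)" using m_gt_3 by simp
  moreover have "\<not> (even m \<and> even r)" using coprime_r_m coprime_common_divisor by fastforce
  ultimately show ?thesis by auto
qed

end
section \<open>Connectedness, automorphisms and isomorphisms of graphs\<close>

text \<open>The set reachable from \<open>x\<close> is one such \<open>S\<close>; since arcs are
  symmetric, any two vertices are then joined through \<open>x\<close>.\<close>

lemma connectedI_closed:
  assumes "pair_graph G" "x \<in> pverts G"
    and closed: "\<And>S. x \<in> S \<Longrightarrow> (\<And>y z. y \<in> S \<Longrightarrow> (y, z) \<in> parcs G \<Longrightarrow> z \<in> S) \<Longrightarrow> pverts G \<subseteq> S"
  shows "Digraph_Component.connected (with_proj G)"
proof -
  interpret pair_graph G by fact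
  have "pverts G \<subseteq> {y. x \<rightarrow>\<^sup>*\<^bsub>with_proj G\<^esub> y}"
  proof (rule closed)
    show "x \<in> {y. x \<rightarrow>\<^sup>*\<^bsub>with_proj G\<^esub> y}" using assms(2) by simp
  next
    fix y z assume "y \<in> {y. x \<rightarrow>\<^sup>*\<^bsub>with_proj G\<^esub> y}" "(y, z) \<in> parcs G"
    then show "z \<in> {y. x \<rightarrow>\<^sup>*\<^bsub>with_proj G\<^esub> y}" by (auto intro: reachable_adj_trans)
  qed
  then have *: "x \<rightarrow>\<^sup>*\<^bsub>with_proj G\<^esub> y" if "y \<in> pverts G" for y using that by auto
  have "y \<rightarrow>\<^sup>*\<^bsub>with_proj G\<^esub> z" if "y \<in> pverts G" "z \<in> pverts G" for y z
    using symmetric_reachable[OF sym_arcs *[OF that(1)]] *[OF that(2)] reachable_trans by blast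
  with assms(2) show ?thesis by (intro connectedI reachable_mk_symmetricI) auto
qed

lemma connected_constant:
  assumes "pair_graph G" "Digraph_Component.connected (with_proj G)"
    and const: "\<And>x y. (x, y) \<in> parcs G \<Longrightarrow> c x = c y"
    and "x \<in> pverts G" "y \<in> pverts G"
  shows "c x = c y"
proof -
  interpret pair_graph G by fact
  have "strongly_connected (with_proj G)"
    using symmetric_connected_imp_strongly_connected[OF sym_arcs] assms(2) by simp
  then have "x \<rightarrow>\<^sup>*\<^bsub>with_proj G\<^esub> y" using assms(4,5) by (auto simp: strongly_connected_def)
  then show ?thesis
    by (induction rule: reachable_induct) (use const in auto)
qed

text \<open>By finiteness an injective map of the vertices into themselves is bijective, and so is
  the map it induces on arcs; hence arcs are reflected as well as preserved.\<close>

lemma Aut_memI: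
  assumes "pair_graph G" and f: "f \<in> extensional (pverts G)" "f ` pverts G \<subseteq> pverts G" "inj_on f (pverts G)"
    and arc: "\<And>x y. (x, y) \<in> parcs G \<Longrightarrow> (f x, f y) \<in> parcs G"
  shows "f \<in> carrier (Aut G)"
proof -
  interpret pair_graph G by fact
  let ?F = "map_prod f f"
  have surj: "f ` pverts G = pverts G"
    by (rule endo_inj_surj) (use f in auto)
  have V: "parcs G \<subseteq> pverts G \<times> pverts G"
    using in_arcsD1 in_arcsD2 by auto
  have "?F ` parcs G = parcs G"
  proof (rule endo_inj_surj)
    show "inj_on ?F (parcs G)"
      by (rule inj_on_subset[OF map_prod_inj_on[OF f(3) f(3)] V])
  qed (use arc in auto)
  have "(x, y) \<in> parcs G" if "x \<in> pverts G" "y \<in> pverts G" "(f x, f y) \<in> parcs G" for x y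
  proof -
    have "(f x, f y) \<in> ?F ` parcs G" using that(3) \<open>?F ` parcs G = parcs G\<close> by simp
    then obtain x' y' where "(x', y') \<in> parcs G" "f x' = f x" "f y' = f y" by auto
    with V that show ?thesis using inj_on_eq_iff[OF f(3)] by auto
  qed
  moreover have "f \<in> Bij (pverts G)"
    using surj f by (simp add: Bij_def bij_betw_def)
  ultimately show ?thesis
    using arc unfolding Aut_def by simp blast
qed

text \<open>Comparing whole neighbourhoods checks preservation and reflection of arcs at once,
  vertex by vertex.\<close>

lemma digraph_isoI:
  assumes "pair_graph G" "pair_graph H"
    and inj: "inj_on \<psi> (pverts G)" and surj: "\<psi> ` pverts G = pverts H"
    and nbrs: "\<And>x y. x \<in> pverts G \<Longrightarrow> (\<psi> x, y) \<in> parcs H \<longleftrightarrow> y \<in> \<psi> ` {z. (x, z) \<in> parcs G}"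
  shows "digraph_iso (with_proj G) (with_proj H)"
proof -
  interpret G: pair_graph G by fact
  interpret H: pair_graph H by fact
  have GV: "parcs G \<subseteq> pverts G \<times> pverts G" using G.in_arcsD1 G.in_arcsD2 by auto
  have HV: "parcs H \<subseteq> pverts H \<times> pverts H" using H.in_arcsD1 H.in_arcsD2 by auto
  have arcs: "map_prod \<psi> \<psi> ` parcs G = parcs H"
  proof (intro equalityI subsetI)
    fix e assume "e \<in> map_prod \<psi> \<psi> ` parcs G"
    then show "e \<in> parcs H" using nbrs GV by auto
  next
    fix e assume e: "e \<in> parcs H"
    obtain x' y where [simp]: "e = (x', y)" by (cases e)
    from e HV have "x' \<in> \<psi> ` pverts G" using surj by auto
    then obtain x where "x \<in> pverts G" "x' = \<psi> x" by blast
    with e nbrs show "e \<in> map_prod \<psi> \<psi> ` parcs G" by fastforce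
  qed
  define h where "h = \<lparr>iso_verts = \<psi>, iso_arcs = map_prod \<psi> \<psi>, iso_head = snd, iso_tail = fst\<rparr>"
  have "G.digraph_isomorphism h"
    unfolding G.digraph_isomorphism_def h_def
    using inj inj_on_subset[OF map_prod_inj_on[OF inj inj] GV] G.wf_digraph_axioms
    by (simp add: map_prod_def split_beta)
  moreover have "with_proj H = app_iso h (with_proj G)"
    using arcs surj by (simp add: with_proj_def app_iso_def h_def)
  ultimately show ?thesis unfolding digraph_iso_def by blast
qed

section \<open>The graphs SDW\<close>

text \<open>Arbitrary integer coordinates are accepted, so that index arithmetic needs no case
  distinction at the ends of the ranges.\<close>

definition SDW_vertex :: "int \<Rightarrow> int \<Rightarrow> int \<Rightarrow> int \<Rightarrow> int \<Rightarrow> int \<times> int \<times> int" where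
  "SDW_vertex m t x i c = (x mod m, i mod t, c)"

lemma pverts_SDW: "pverts (SDW m t) = {0..<m} \<times> {0..<t} \<times> {0..<2}"
  by (simp add: SDW_def graph_of_def)

lemma SDW_vertexE:
  assumes "z \<in> pverts (SDW m t)"
  obtains x i where "0 \<le> x" "x < m" "0 \<le> i" "i < t" "z = SDW_vertex m t x i 0"
  | x i where "0 \<le> x" "x < m" "0 \<le> i" "i < t" "z = SDW_vertex m t x i 1"
proof -
  obtain x i c where z: "z = (x, i, c)" by (metis surj_pair)
  with assms have "0 \<le> x" "x < m" "0 \<le> i" "i < t" "c = 0 \<or> c = 1"
    by (auto simp: pverts_SDW)
  then show ?thesis using that[of x i] z by (auto simp: SDW_vertex_def)
qed

lemma SDW_arcs:
  assumes "m > 0" "t > 0"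
  shows "(SDW_vertex m t x i 0, y) \<in> parcs (SDW m t) \<longleftrightarrow>
      y = SDW_vertex m t x (i + 1) 1 \<or> y = SDW_vertex m t x (i - 1) 1 \<or> y = SDW_vertex m t (x - 1) i 1" (is ?A)
    and "(SDW_vertex m t x i 1, y) \<in> parcs (SDW m t) \<longleftrightarrow>
      y = SDW_vertex m t x (i + 1) 0 \<or> y = SDW_vertex m t x (i - 1) 0 \<or> y = SDW_vertex m t (x + 1) i 0" (is ?B)
proof -
  obtain x' i' c' where y: "y = (x', i', c')" by (metis surj_pair)
  have *: "0 \<le> k mod m" "k mod m < m" "0 \<le> k mod t" "k mod t < t" for k using assms by auto
  \<comment> \<open>An edge listed from its other end gives an equation for the coordinate of
    \<open>y\<close>; \<open>dec\<close> and \<open>inc\<close> solve it.\<close>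
  have dec: "x mod m = (k + 1) mod m \<and> 0 \<le> k \<and> k < m \<longleftrightarrow> k = (x - 1) mod m"
    if "m > 0" for x k m :: int
  proof -
    have "x mod m = (k + 1) mod m \<longleftrightarrow> (x - 1) mod m = k mod m" 
      by (metis add_diff_cancel_right' diff_add_cancel mod_add_left_eq mod_diff_left_eq)
    then show ?thesis using that by auto
  qed
  have inc: "x mod m = (k - 1) mod m \<and> 0 \<le> k \<and> k < m \<longleftrightarrow> k = (x + 1) mod m"
    if "m > 0" for x k m :: int
  proof -
    have "x mod m = (k - 1) mod m \<longleftrightarrow> (x + 1) mod m = k mod m" 
      by (metis add_diff_cancel_right' diff_add_cancel mod_add_left_eq mod_diff_left_eq)
    then show ?thesis using that by auto
  qed
  show ?A
    using * dec[OF assms(1), of x x'] dec[OF assms(2), of i i'] inc[OF assms(2), of i i']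
    by (auto simp: SDW_def graph_of_def SDW_vertex_def doubleton_eq_iff y mod_simps)
  show ?B
    using * inc[OF assms(1), of x x'] dec[OF assms(2), of i i'] inc[OF assms(2), of i i']
    by (auto simp: SDW_def graph_of_def SDW_vertex_def doubleton_eq_iff y mod_simps)
qed

lemma SDW_vertex_in_pverts: "m > 0 \<Longrightarrow> t > 0 \<Longrightarrow> c = 0 \<or> c = 1 \<Longrightarrow> SDW_vertex m t x i c \<in> pverts (SDW m t)"
  by (auto simp: SDW_vertex_def pverts_SDW)

lemma SDW_vertex_eq_iff: "SDW_vertex m t x i c = SDW_vertex m t x' i' c' \<longleftrightarrow> [x = x'] (mod m) \<and> [i = i'] (mod t) \<and> c = c'"
  by (simp add: SDW_vertex_def cong_def)

lemma cong_sign_cancel: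
  fixes e :: int
  assumes "e * e = 1"
  shows "[e * x + d = e * y + d] (mod n) \<longleftrightarrow> [x = y] (mod n)"
proof
  assume "[e * x + d = e * y + d] (mod n)"
  then have "[e * (e * x) = e * (e * y)] (mod n)" by (simp add: cong_add_rcancel cong_scalar_left)
  with assms show "[x = y] (mod n)" by (simp flip: mult.assoc)
qed (simp add: cong_add_rcancel cong_scalar_left)

lemma mod_linear: "(e * (x mod n) + d) mod n = (e * x + d) mod n" for e x d n :: int
  by (metis mod_add_left_eq mod_mult_right_eq)

section \<open>Automorphisms of \<open>SDW\<close>\<close>

text \<open>The edges that change \<open>x\<close> lead from layer 1 to layer 0 as \<open>x\<close>
  grows, so reversing the direction of \<open>x\<close> must swap the two layers.\<close>

definition SDW_aut :: "int \<Rightarrow> int \<Rightarrow> int \<Rightarrow> int \<Rightarrow> int \<Rightarrow> int \<Rightarrow> int \<times> int \<times> int \<Rightarrow> int \<times> int \<times> int" where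
  "SDW_aut m t \<delta> d \<epsilon> e = (\<lambda>(x, i, c) \<in> pverts (SDW m t).
     SDW_vertex m t (\<delta> * x + d) (\<epsilon> * i + e) (if \<delta> = 1 then c else 1 - c))"

lemma SDW_aut_SDW_vertex:
  assumes "m > 0" "t > 0" "c = 0 \<or> c = 1"
  shows "SDW_aut m t \<delta> d \<epsilon> e (SDW_vertex m t x i c) =
    SDW_vertex m t (\<delta> * x + d) (\<epsilon> * i + e) (if \<delta> = 1 then c else 1 - c)"
  using SDW_vertex_in_pverts[OF assms]
  by (simp add: SDW_aut_def SDW_vertex_def mod_linear)

lemma SDW_aut_in_Aut:
  assumes m: "m > 0" and t: "t > 0" and \<delta>: "\<delta> = 1 \<or> \<delta> = - 1" and \<epsilon>: "\<epsilon> = 1 \<or> \<epsilon> = - 1"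
  shows "SDW_aut m t \<delta> d \<epsilon> e \<in> carrier (Aut (SDW m t))"
proof (rule Aut_memI)
  let ?f = "SDW_aut m t \<delta> d \<epsilon> e"
  have sq: "\<delta> * \<delta> = 1" "\<epsilon> * \<epsilon> = 1" using \<delta> \<epsilon> by auto
  show G: "pair_graph (SDW m t)" using m t by (rule pair_graph_SDW)
  show "?f \<in> extensional (pverts (SDW m t))"
    by (simp add: SDW_aut_def)
  show "?f ` pverts (SDW m t) \<subseteq> pverts (SDW m t)"
    by (auto elim!: SDW_vertexE simp: SDW_aut_SDW_vertex m t intro!: SDW_vertex_in_pverts m t)
  show "inj_on ?f (pverts (SDW m t))"
  proof (rule inj_onI)
    fix y z assume "y \<in> pverts (SDW m t)" "z \<in> pverts (SDW m t)" "?f y = ?f z"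
    then show "y = z"
      by (elim SDW_vertexE)
        (simp_all add: SDW_aut_SDW_vertex m t SDW_vertex_eq_iff cong_sign_cancel sq split: if_splits)
  qed
  fix y z assume yz: "(y, z) \<in> parcs (SDW m t)"
  interpret pair_graph "SDW m t" by (rule G)
  have "y \<in> pverts (SDW m t)" using in_arcsD1[OF yz] .
  then show "(?f y, ?f z) \<in> parcs (SDW m t)"
    using yz \<delta> \<epsilon> m t
    by (elim SDW_vertexE) (auto simp: SDW_aut_SDW_vertex SDW_arcs algebra_simps)
qed

text \<open>Translations act transitively on each layer, and the reversal of \<open>x\<close>
  exchanges the layers.\<close>

lemma vertex_transitive_SDW:
  assumes "m > 0" "t > 0"
  shows "vertex_transitive (SDW m t)"
  unfolding vertex_transitive_def
proof (intro ballI)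
  fix y z assume y: "y \<in> pverts (SDW m t)" and z: "z \<in> pverts (SDW m t)"
  obtain x i c where y': "y = SDW_vertex m t x i c" "c = 0 \<or> c = 1" using y by (elim SDW_vertexE) auto
  obtain x' i' c' where z': "z = SDW_vertex m t x' i' c'" "c' = 0 \<or> c' = 1" using z by (elim SDW_vertexE) auto
  define \<delta> :: int where "\<delta> = (if c = c' then 1 else - 1)"
  let ?f = "SDW_aut m t \<delta> (x' - \<delta> * x) 1 (i' - i)"
  have "?f \<in> carrier (Aut (SDW m t))"
    by (rule SDW_aut_in_Aut) (use assms in \<open>auto simp: \<delta>_def\<close>)
  moreover have "?f y = z"
    unfolding y' by (subst SDW_aut_SDW_vertex) (use assms y'(2) z' in \<open>auto simp: \<delta>_def\<close>)
  ultimately show "\<exists>f \<in> carrier (Aut (SDW m t)). f y = z" by blast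
qed

text \<open>Two steps along a rim add 2 to \<open>i\<close>, and 2 generates the residues modulo 3,
  so each rim is connected; the remaining edges join successive rims.\<close>

lemma connected_SDW:
  assumes "m > 0"
  shows "Digraph_Component.connected (SDW m 3)"
proof (rule connectedI_closed)
  show "pair_graph (SDW m 3)" using assms by (simp add: pair_graph_SDW)
  show "SDW_vertex m 3 0 0 0 \<in> pverts (SDW m 3)" using assms by (simp add: SDW_vertex_in_pverts)
  fix S assume 0: "SDW_vertex m 3 0 0 0 \<in> S"
    and cl: "\<And>y z. y \<in> S \<Longrightarrow> (y, z) \<in> parcs (SDW m 3) \<Longrightarrow> z \<in> S"
  have out: "SDW_vertex m 3 x (i + 1) 1 \<in> S" if "SDW_vertex m 3 x i 0 \<in> S" for x i
    using cl[OF that] assms by (auto simp: SDW_arcs)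
  have spoke: "SDW_vertex m 3 x (i + 1) 0 \<in> S" "SDW_vertex m 3 (x + 1) i 0 \<in> S"
    if "SDW_vertex m 3 x i 1 \<in> S" for x i
    using cl[OF that] assms by (auto simp: SDW_arcs)
  have two: "SDW_vertex m 3 x (i + 2) 0 \<in> S" if "SDW_vertex m 3 x i 0 \<in> S" for x i
    using spoke(1)[OF out[OF that]] by (simp add: add.assoc)
  have one: "SDW_vertex m 3 x (i + 1) 0 \<in> S" if "SDW_vertex m 3 x i 0 \<in> S" for x i
  proof -
    have "SDW_vertex m 3 x (i + 2 + 2) 0 = SDW_vertex m 3 x (i + 1) 0"
      by (simp add: SDW_vertex_eq_iff cong_iff_dvd_diff)
    with two[OF two[OF that]] show ?thesis by simp
  qed
  have rim: "SDW_vertex m 3 x (i + int n) 0 \<in> S" if "SDW_vertex m 3 x i 0 \<in> S" for x i n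
    by (induction n) (use that one in \<open>force simp: algebra_simps\<close>)+
  have zero: "SDW_vertex m 3 (int n) 0 0 \<in> S" for n
  proof (induction n)
    case (Suc n)
    \<comment> \<open>Index 2 is chosen so that the step to layer 1 ends at 3, which is 0 modulo
      3.\<close>
    have "SDW_vertex m 3 (int n) 3 1 \<in> S" using out[OF rim[OF Suc, of 2]] by simp
    from spoke(2)[OF this] have "SDW_vertex m 3 (int n + 1) 3 0 \<in> S" .
    moreover have "SDW_vertex m 3 (int n + 1) 3 0 = SDW_vertex m 3 (int (Suc n)) 0 0"
      by (simp add: SDW_vertex_eq_iff cong_def algebra_simps)
    ultimately show ?case by simp
  qed (simp add: 0)
  have all0: "SDW_vertex m 3 (int n) (int k) 0 \<in> S" for n k
    using rim[OF zero[of n], of k] by simp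
  have all1: "SDW_vertex m 3 (int n) (int k) 1 \<in> S" for n k
  proof -
    have "SDW_vertex m 3 (int n) (int (k + 2) + 1) 1 = SDW_vertex m 3 (int n) (int k) 1"
      by (simp add: SDW_vertex_eq_iff cong_iff_dvd_diff)
    with out[OF all0[of n "k + 2"]] show ?thesis by simp
  qed
  show "pverts (SDW m 3) \<subseteq> S"
  proof
    fix z assume "z \<in> pverts (SDW m 3)"
    then show "z \<in> S"
    proof (cases rule: SDW_vertexE)
      case (1 x i)
      then show ?thesis using all0[of "nat x" "nat i"] by simp
    next
      case (2 x i)
      then show ?thesis using all1[of "nat x" "nat i"] by simp
    qed
  qed
qed

text \<open>The map translates \<open>x\<close> by one and negates \<open>i\<close>; the two parts
  act on different coordinates, so their powers are taken separately.\<close>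

lemma Aut_pow_SDW:
  assumes "m > 0" "t > 0"
  shows "SDW_aut m t 1 1 (- 1) 0 [^]\<^bsub>Aut (SDW m t)\<^esub> n = SDW_aut m t 1 (int n) ((- 1) ^ n) 0"
proof (induction n)
  case 0
  have "SDW_aut m t 1 0 1 0 = (\<lambda>x\<in>pverts (SDW m t). x)"
    by (auto simp: fun_eq_iff SDW_aut_def SDW_vertex_def pverts_SDW)
  then show ?case by (simp add: Aut_def BijGroup_def)
next
  case (Suc n)
  let ?f = "SDW_aut m t 1 1 (- 1) 0" and ?g = "SDW_aut m t 1 (int n) ((- 1) ^ n) 0"
  let ?h = "SDW_aut m t 1 (int (Suc n)) ((- 1) ^ Suc n) 0"
  have sgn: "(- 1 :: int) ^ n = 1 \<or> (- 1 :: int) ^ n = - 1" by (cases "even n") auto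
  have f: "?f \<in> carrier (Aut (SDW m t))" and g: "?g \<in> carrier (Aut (SDW m t))"
    using assms sgn by (intro SDW_aut_in_Aut; simp)+
  then have "?g \<otimes>\<^bsub>Aut (SDW m t)\<^esub> ?f = compose (pverts (SDW m t)) ?g ?f"
    by (simp add: Aut_def BijGroup_def)
  also have "\<dots> = ?h"
  proof
    fix z show "compose (pverts (SDW m t)) ?g ?f z = ?h z"
    proof (cases "z \<in> pverts (SDW m t)")
      case True
      then obtain x i c where z: "z = SDW_vertex m t x i c" "c = 0 \<or> c = 1" by (elim SDW_vertexE) auto
      show ?thesis
        using True assms z(2) sgn
        by (simp add: compose_eq z(1) SDW_aut_SDW_vertex algebra_simps)
    qed (simp add: compose_def SDW_aut_def)
  qed
  finally show ?case using Suc by simp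
qed

text \<open>The translation has order \<open>m\<close> and the negation modulo 3 has order 2; for
  odd \<open>m\<close> these orders are coprime.\<close>

lemma SDW_aut_order:
  assumes "m > 0" "odd m"
  shows "int (group.ord (Aut (SDW m 3)) (SDW_aut m 3 1 1 (- 1) 0)) = 2 * m"
proof -
  interpret A: group "Aut (SDW m 3)" by (rule group_Aut)
  let ?f = "SDW_aut m 3 1 1 (- 1) 0"
  have one: "\<one>\<^bsub>Aut (SDW m 3)\<^esub> = SDW_aut m 3 1 0 1 0"
    using Aut_pow_SDW[OF assms(1), of 3 0] by simp
  have "SDW_aut m 3 1 (int n) ((- 1) ^ n) 0 = SDW_aut m 3 1 0 1 0 \<longleftrightarrow> nat (2 * m) dvd n" for n
  proof -
    have sgn: "(- 1 :: int) ^ n = 1 \<or> (- 1 :: int) ^ n = - 1" by (cases "even n") auto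
    note w = SDW_aut_SDW_vertex[OF assms(1), of 3]
    have "m dvd int n \<and> even n" if "SDW_aut m 3 1 (int n) ((- 1) ^ n) 0 = SDW_aut m 3 1 0 1 0"
    proof -
      \<comment> \<open>The vertex with \<open>i = 1\<close> reveals both parts, since negation
        moves 1 modulo 3.\<close>
      have "SDW_vertex m 3 (int n) ((- 1) ^ n) 0 = SDW_vertex m 3 0 1 0"
        using fun_cong[OF that, of "SDW_vertex m 3 0 1 0"] sgn by (simp add: w)
      then have "[int n = 0] (mod m)" "[(- 1) ^ n = 1] (mod 3 :: int)"
        by (simp_all add: SDW_vertex_eq_iff)
      then show ?thesis by (cases "even n") (auto simp: cong_0_iff cong_def)
    qed
    moreover have "SDW_aut m 3 1 (int n) ((- 1) ^ n) 0 = SDW_aut m 3 1 0 1 0" if "m dvd int n" "even n"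
    proof
      fix z show "SDW_aut m 3 1 (int n) ((- 1) ^ n) 0 z = SDW_aut m 3 1 0 1 0 z"
        using that by (cases z) (simp add: SDW_aut_def SDW_vertex_eq_iff cong_iff_dvd_diff)
    qed
    moreover have "m dvd int n \<and> even n \<longleftrightarrow> 2 * m dvd int n"
    proof
      have "coprime 2 m" using assms(2) by simp
      then show "m dvd int n \<and> even n \<Longrightarrow> 2 * m dvd int n"
        by (intro divides_mult) auto
    next
      assume "2 * m dvd int n"
      then have "m dvd int n" "2 dvd int n" using dvd_mult_left dvd_mult_right by blast+
      then show "m dvd int n \<and> even n" by simp
    qed
    moreover have "2 * m dvd int n \<longleftrightarrow> nat (2 * m) dvd n" 
      using assms(1) by (simp add: nat_dvd_iff flip: int_dvd_int_iff)
    ultimately show ?thesis by blast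
  qed
  then have "group.ord (Aut (SDW m 3)) ?f = nat (2 * m)"
    using Aut_pow_SDW[OF assms(1), of 3] SDW_aut_in_Aut[OF assms(1), of 3 1 "- 1"]
    by (subst A.ord_unique) (simp_all add: one)
  with assms(1) show ?thesis by simp
qed

section \<open>The untwisted necklace\<close>

context hexagon_necklace
begin

text \<open>The values \<open>l\<close> and \<open>l + 1\<close> cover both parities, so they may
  replace 0 and 1.\<close>

lemma E_a_any: "E (a k) y \<longleftrightarrow> y = u k l \<or> y = u k (l + 1) \<or> y = b (k + 2)"
proof (cases "even l")
  case True
  then have "u k 0 = u k l" "u k 1 = u k (l + 1)" by simp_all
  then show ?thesis by (simp only: E_a)
next
  case False
  then have "u k 1 = u k l" "u k 0 = u k (l + 1)" by simp_all
  then show ?thesis by (simp only: E_a) blast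
qed

lemma E_b_any: "E (b k) y \<longleftrightarrow> y = v k l \<or> y = v k (l + 1) \<or> y = a (k - 2)"
  using hexagon_necklace.E_a_any[OF reversed, of "- k" y l] by simp

lemma in_vertices [simp]:
  "u k l \<in> vertices" "v k l \<in> vertices" "a k \<in> vertices" "b k \<in> vertices"
  unfolding vertices_def by force+

text \<open>The rim over \<open>x\<close> becomes the hexagon on \<open>u (x - 1)\<close>,
  \<open>a (x - 1)\<close>, \<open>v x\<close> and \<open>b x\<close>, and the other edges become
  the matching. The second coordinate grows with \<open>x\<close> to compensate the twist on going
  once around.\<close>

definition from_SDW :: "int \<times> int \<times> int \<Rightarrow> 'a" where
  "from_SDW = (\<lambda>(x, i, c).
     if i = 2 then if c = 0 then b x else a (x - 1)
     else if c = 0 then u (x - 1) (x - 1 + i) else v x (x + i))"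

context
  assumes odd_m: "odd m" and odd_r: "odd r"
begin

text \<open>Here parity enters: the index difference is \<open>(k - k') * (r + m)\<close>, where
  \<open>m\<close> divides the first factor and 2 the second.\<close>

lemma periodic:
  assumes "[k = k'] (mod m)"
  shows "u k (k + l) = u k' (k' + l)" "v k (k + l) = v k' (k' + l)" "a k = a k'" "b k = b k'"
proof -
  from assms obtain t where t: "k - k' = m * t" by (auto simp: cong_iff_dvd_diff)
  then show "a k = a k'" "b k = b k'" by (simp_all add: a_eq b_eq)
  have "(k - k') * r + (k + l - (k' + l)) * m = (k - k') * (r + m)" by (simp add: algebra_simps)
  moreover have "2 * m dvd (k - k') * (r + m)"
    using odd_m odd_r by (simp add: t mult_dvd_mono mult.commute[of 2])
  ultimately show "u k (k + l) = u k' (k' + l)" "v k (k + l) = v k' (k' + l)"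
    by (simp_all only: u_eq v_eq)
qed

lemma from_SDW_SDW_vertex:
  "from_SDW (SDW_vertex m 3 x i c) =
    (if i mod 3 = 2 then if c = 0 then b x else a (x - 1)
     else if c = 0 then u (x - 1) (x - 1 + i mod 3) else v x (x + i mod 3))"
proof -
  have 1: "[x mod m = x] (mod m)" by simp
  then have 2: "[x mod m - 1 = x - 1] (mod m)" by (intro cong_diff) simp_all
  show ?thesis
    using periodic[OF 1] periodic[OF 2] by (simp add: from_SDW_def SDW_vertex_def)
qed

lemma digraph_iso_SDW:
  assumes G: "pair_graph G" "pverts G = vertices"
    and E: "\<And>x y. x \<in> vertices \<Longrightarrow> (x, y) \<in> parcs G \<longleftrightarrow> E x y"
  shows "digraph_iso (SDW m 3) G"
proof (rule digraph_isoI)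
  let ?S = "pverts (SDW m 3)"
  show "pair_graph (SDW m 3)" using m_gt_3 by (simp add: pair_graph_SDW)
  show "pair_graph G" by fact
  show img: "from_SDW ` ?S = pverts G"
  proof
    show "from_SDW ` ?S \<subseteq> pverts G"
      by (auto simp: from_SDW_def G)
    show "pverts G \<subseteq> from_SDW ` ?S"
    proof
      fix z assume "z \<in> pverts G"
      then have "z \<in> vertices" using G by simp
      \<comment> \<open>Only the parity of the second coordinate matters, so one of the two values
        of \<open>i\<close> reaches it.\<close>
      moreover have par: "\<exists>i\<in>{0, 1}. even (l - k - i)" for l k :: int
        by (cases "even (l - k)") auto
      moreover have mem: "from_SDW (SDW_vertex m 3 x i c) \<in> from_SDW ` ?S" if "c = 0 \<or> c = 1" for x i c
        using that m_gt_3 by (intro imageI SDW_vertex_in_pverts) auto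
      ultimately show "z \<in> from_SDW ` ?S"
      proof (cases rule: verticesE)
        case (u k l)
        obtain i where i: "i = 0 \<or> i = 1" "even (l - k - i)" using par[of l k] by auto
        then have "from_SDW (SDW_vertex m 3 (k + 1) i 0) = u k (k + i)" by (auto simp: from_SDW_SDW_vertex)
        also have "\<dots> = z" using i u by auto
        finally show ?thesis using mem by metis
      next
        case (v k l)
        obtain i where i: "i = 0 \<or> i = 1" "even (l - k - i)" using par[of l k] by auto
        then have "from_SDW (SDW_vertex m 3 k i 1) = v k (k + i)" by (auto simp: from_SDW_SDW_vertex)
        also have "\<dots> = z" using i v by auto
        finally show ?thesis using mem by metis
      next
        case (a k)
        then have "from_SDW (SDW_vertex m 3 (k + 1) 2 1) = z" by (simp add: from_SDW_SDW_vertex)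
        then show ?thesis using mem by metis
      next
        case (b k)
        then have "from_SDW (SDW_vertex m 3 k 2 0) = z" by (simp add: from_SDW_SDW_vertex)
        then show ?thesis using mem by metis
      qed
    qed
  qed
  have third: "i = 0 \<or> i = 1 \<or> i = 2" if "0 \<le> i" "i < 3" for i :: int using that by auto
  show "inj_on from_SDW ?S"
  proof (rule inj_onI)
    \<comment> \<open>First coordinates now range over all residues, beyond the reach of
      \<open>near\<close>; their bounds take over the role of the distance 3.\<close>
    have far: "2 * m dvd (x - y) * r + (x - y + j) * m \<Longrightarrow> x = y \<and> even j"
      if "0 \<le> x" "x < m" "0 \<le> y" "y < m" for x y j
    proof -
      assume *: "2 * m dvd (x - y) * r + (x - y + j) * m"
      then have "m dvd (x - y) * r + (x - y + j) * m" using dvd_mult_right by blast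
      then have "m dvd (x - y) * r" by (simp add: dvd_add_left_iff)
      then have "m dvd x - y"
        using coprime_r_m by (simp add: coprime_commute coprime_dvd_mult_left_iff)
      then have "[x = y] (mod m)" by (simp add: cong_iff_dvd_diff)
      then have "x = y" using that by (simp add: cong_def)
      with * m_gt_3 show "x = y \<and> even j" by simp
    qed
    have far': "m dvd x - y \<Longrightarrow> x = y" if "0 \<le> x" "x < m" "0 \<le> y" "y < m" for x y
      using that by (simp add: cong_def flip: cong_iff_dvd_diff)
    have coords: "\<exists>x i c. w = (x, i, c) \<and> 0 \<le> x \<and> x < m \<and> (i = 0 \<or> i = 1 \<or> i = 2) \<and> (c = 0 \<or> c = 1)"
      if "w \<in> ?S" for w
      using that by (cases w) (auto simp: pverts_SDW)
    fix y z assume yz: "y \<in> ?S" "z \<in> ?S" and eq: "from_SDW y = from_SDW z"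
    obtain x i c x' i' c' where
      y: "y = (x, i, c)" "0 \<le> x" "x < m" "i = 0 \<or> i = 1 \<or> i = 2" "c = 0 \<or> c = 1" and
      z: "z = (x', i', c')" "0 \<le> x'" "x' < m" "i' = 0 \<or> i' = 1 \<or> i' = 2" "c' = 0 \<or> c' = 1"
      using coords[OF yz(1)] coords[OF yz(2)] by blast
    have U: "x = x' \<and> even (i - i')" if "u (x - 1) (x - 1 + i) = u (x' - 1) (x' - 1 + i')"
      using far[OF y(2,3) z(2,3), of "i - i'"] that by (simp add: u_eq algebra_simps)
    have V: "x = x' \<and> even (i - i')" if "v x (x + i) = v x' (x' + i')"
      using far[OF y(2,3) z(2,3), of "i - i'"] that by (simp add: v_eq algebra_simps)
    have A: "x = x'" if "a (x - 1) = a (x' - 1)"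
      using far'[OF y(2,3) z(2,3)] that by (simp add: a_eq)
    have B: "x = x'" if "b x = b x'"
      using far'[OF y(2,3) z(2,3)] that by (simp add: b_eq)
    have "c = c' \<and> (i = 2 \<longleftrightarrow> i' = 2)"
      using eq y(4,5) z(4,5) unfolding y(1) z(1) from_SDW_def by (auto split: if_splits)
    then have "c = c'" "i = 2 \<longleftrightarrow> i' = 2" by auto
    moreover have "x = x'" and "i \<noteq> 2 \<longrightarrow> even (i - i')"
      using eq U V A B calculation unfolding y(1) z(1) from_SDW_def prod.case by presburger+
    ultimately show "y = z" using y(4) z(4) unfolding y(1) z(1) by auto
  qed
  fix z y assume z: "z \<in> ?S"
  then have "from_SDW z \<in> vertices" using img G by auto
  then have "(from_SDW z, y) \<in> parcs G \<longleftrightarrow> E (from_SDW z) y" by (rule E)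
  also have "\<dots> \<longleftrightarrow> y \<in> from_SDW ` {w. (z, w) \<in> parcs (SDW m 3)}"
  proof -
    have m: "m > 0" "(3 :: int) > 0" using m_gt_3 by auto
    show ?thesis
      using z
    proof (cases rule: SDW_vertexE)
      case (1 x i)
      have "{w. (z, w) \<in> parcs (SDW m 3)} =
          {SDW_vertex m 3 x (i + 1) 1, SDW_vertex m 3 x (i - 1) 1, SDW_vertex m 3 (x - 1) i 1}"
        using 1(5) by (auto simp: SDW_arcs[OF m])
      \<comment> \<open>This identifies the neighbour given by \<open>E_u\<close> with the image of
        the rim neighbour when \<open>i = 0\<close>.\<close>
      moreover have "v x (x - 1) = v x (x + 1)" by simp
      ultimately show ?thesis
        using third[OF 1(3,4)] 1(5)
        by (auto simp: from_SDW_SDW_vertex E_u E_b_any[of x y x])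
    next
      case (2 x i)
      have "{w. (z, w) \<in> parcs (SDW m 3)} =
          {SDW_vertex m 3 x (i + 1) 0, SDW_vertex m 3 x (i - 1) 0, SDW_vertex m 3 (x + 1) i 0}"
        using 2(5) by (auto simp: SDW_arcs[OF m])
      moreover have "u (x - 1) (x + 1) = u (x - 1) (x - 1)" by simp
      ultimately show ?thesis
        using third[OF 2(3,4)] 2(5)
        by (auto simp: from_SDW_SDW_vertex E_v E_a_any[of "x - 1" y "x - 1"])
    qed
  qed
  finally show "(from_SDW z, y) \<in> parcs G \<longleftrightarrow> y \<in> from_SDW ` {w. (z, w) \<in> parcs (SDW m 3)}" .
qed

end

end

section \<open>The graphs Gamma12\<close>

definition gu :: "int \<Rightarrow> int \<Rightarrow> gamma_vertex" where "gu m i = U (i mod (2 * m))"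
definition gv :: "int \<Rightarrow> int \<Rightarrow> gamma_vertex" where "gv m i = V (i mod (2 * m))"
definition ga :: "int \<Rightarrow> int \<Rightarrow> gamma_vertex" where "ga m i = A (i mod m)"
definition gb :: "int \<Rightarrow> int \<Rightarrow> gamma_vertex" where "gb m i = B (i mod m)"

lemmas gamma_vertex_defs = gu_def gv_def ga_def gb_def

lemma gamma_vertex_eq_iff:
  "gu m i = gu m j \<longleftrightarrow> 2 * m dvd i - j"
  "gv m i = gv m j \<longleftrightarrow> 2 * m dvd i - j"
  "ga m i = ga m j \<longleftrightarrow> m dvd i - j"
  "gb m i = gb m j \<longleftrightarrow> m dvd i - j"
  by (simp_all add: gamma_vertex_defs mod_eq_dvd_iff)

lemma gamma_vertex_neq [simp]:
  "gu m i \<noteq> gv m j" "gu m i \<noteq> ga m j" "gu m i \<noteq> gb m j"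
  "gv m i \<noteq> gu m j" "gv m i \<noteq> ga m j" "gv m i \<noteq> gb m j"
  "ga m i \<noteq> gu m j" "ga m i \<noteq> gv m j" "ga m i \<noteq> gb m j"
  "gb m i \<noteq> gu m j" "gb m i \<noteq> gv m j" "gb m i \<noteq> ga m j"
  by (simp_all add: gamma_vertex_defs)

lemma pverts_Gamma12:
  assumes "m > 0"
  shows "pverts (Gamma12 m r s) = range (gu m) \<union> range (gv m) \<union> range (ga m) \<union> range (gb m)"
proof -
  have rng: "range (\<lambda>i. i mod n) = {0..<n}" if "n > 0" for n :: int
  proof
    show "{0..<n} \<subseteq> range (\<lambda>i. i mod n)"
    proof
      fix x assume "x \<in> {0..<n}"
      then have "x = x mod n" by simp
      then show "x \<in> range (\<lambda>i. i mod n)" by blast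
    qed
  qed (use that in auto)
  have *: "range (\<lambda>i. C (i mod n)) = C ` {0..<n}" if "n > 0" for n :: int and C :: "int \<Rightarrow> gamma_vertex"
  proof -
    have "range (\<lambda>i. C (i mod n)) = C ` range (\<lambda>i. i mod n)" by (simp add: image_image)
    with rng[OF that] show ?thesis by simp
  qed
  from assms show ?thesis
    by (simp add: Gamma12_def graph_of_def gamma_vertex_defs[abs_def] *[of "2 * m"] *[of m])
qed

text \<open>A residue modulo \<open>m\<close> has exactly two lifts modulo \<open>2 * m\<close>;
  they are the two \<open>u\<close> or \<open>v\<close> neighbours of an \<open>a\<close> or
  \<open>b\<close> vertex.\<close>

lemma mod_double_cases:
  fixes i j m :: int
  assumes "m > 0"
  shows "j mod m = i mod m \<and> 0 \<le> j \<and> j < 2 * m \<longleftrightarrow> j = i mod (2 * m) \<or> j = (i + m) mod (2 * m)"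
proof (intro iffI; elim conjE disjE)
  assume "j mod m = i mod m" "0 \<le> j" "j < 2 * m"
  then obtain t where t: "j = i + m * t" by (metis mod_eqE)
  have "j = j mod (2 * m)" using \<open>0 \<le> j\<close> \<open>j < 2 * m\<close> by simp
  also have "\<dots> = i mod (2 * m) \<or> \<dots> = (i + m) mod (2 * m)"
  proof (cases "even t")
    case True
    then show ?thesis by (auto elim!: evenE simp: t mod_eq_dvd_iff)
  next
    case False
    then show ?thesis by (auto elim!: oddE simp: t mod_eq_dvd_iff algebra_simps)
  qed
  finally show "j = i mod (2 * m) \<or> j = (i + m) mod (2 * m)" .
qed (use assms in \<open>auto simp: mod_mod_cancel\<close>)

lemma Gamma12_arcs:
  assumes m: "m > 0"
  shows "(gu m i, y) \<in> parcs (Gamma12 m r s) \<longleftrightarrow> y = gv m i \<or> y = gv m (i + r) \<or> y = ga m i" (is ?U)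
    and "(gv m i, y) \<in> parcs (Gamma12 m r s) \<longleftrightarrow> y = gu m i \<or> y = gu m (i - r) \<or> y = gb m i" (is ?V)
    and "(ga m i, y) \<in> parcs (Gamma12 m r s) \<longleftrightarrow> y = gu m i \<or> y = gu m (i + m) \<or> y = gb m (i + s)" (is ?A)
    and "(gb m i, y) \<in> parcs (Gamma12 m r s) \<longleftrightarrow> y = gv m i \<or> y = gv m (i + m) \<or> y = ga m (i - s)" (is ?B)
proof -
  have * [simp]: "0 \<le> k mod (2 * m)" "k mod (2 * m) < 2 * m" "0 \<le> k mod m" "k mod m < m" for k
    using m by auto
  have [simp]: "k mod (2 * m) mod m = k mod m" for k by (simp add: mod_mod_cancel)
  have dec: "i mod n = (k + e) mod n \<and> 0 \<le> k \<and> k < n \<longleftrightarrow> k = (i - e) mod n"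
    if "n > 0" for i k e n :: int
  proof -
    have "i mod n = (k + e) mod n \<longleftrightarrow> (i - e) mod n = k mod n"
      by (simp add: mod_eq_dvd_iff algebra_simps)
    then show ?thesis using that by auto
  qed
  have m2: "2 * m > 0" using m by simp
  show ?U
    by (cases y) (auto simp: Gamma12_def graph_of_def gamma_vertex_defs doubleton_eq_iff mod_simps)
  show ?V
    using dec[OF m2, of i _ r]
    by (cases y) (auto simp: Gamma12_def graph_of_def gamma_vertex_defs doubleton_eq_iff mod_simps)
  show ?A
  proof (cases y)
    case (U j)
    have "(ga m i, U j) \<in> parcs (Gamma12 m r s) \<longleftrightarrow> j mod m = i mod m \<and> 0 \<le> j \<and> j < 2 * m"
      by (auto simp: Gamma12_def graph_of_def gamma_vertex_defs doubleton_eq_iff)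
    then show ?thesis
      unfolding U mod_double_cases[OF m] by (simp add: gamma_vertex_defs)
  next
    case (B j)
    then show ?thesis
      by (auto simp: Gamma12_def graph_of_def gamma_vertex_defs doubleton_eq_iff mod_simps)
  qed (auto simp: Gamma12_def graph_of_def gamma_vertex_defs doubleton_eq_iff)
  show ?B
  proof (cases y)
    case (V j)
    have "(gb m i, V j) \<in> parcs (Gamma12 m r s) \<longleftrightarrow> j mod m = i mod m \<and> 0 \<le> j \<and> j < 2 * m"
      by (auto simp: Gamma12_def graph_of_def gamma_vertex_defs doubleton_eq_iff)
    then show ?thesis
      unfolding V mod_double_cases[OF m] by (simp add: gamma_vertex_defs)
  next
    case (A j)
    have "(gb m i, A j) \<in> parcs (Gamma12 m r s) \<longleftrightarrow> i mod m = (j + s) mod m \<and> 0 \<le> j \<and> j < m"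
      by (auto simp: Gamma12_def graph_of_def gamma_vertex_defs doubleton_eq_iff)
    then show ?thesis
      unfolding A dec[OF m] by (simp add: gamma_vertex_defs)
  qed (auto simp: Gamma12_def graph_of_def gamma_vertex_defs doubleton_eq_iff)
qed

section \<open>Consequences of vertex transitivity and connectedness\<close>

text \<open>With indices written after the letters, the hexagons \<open>u0 v0 b0 vm um a0\<close>
  and \<open>u0 vr br v(r+m) um a0\<close> together cover the three edges at
  \<open>u0\<close>.\<close>

lemma Gamma12_u_edges_on_hexagons:
  assumes "m > 0" "(gu m 0, y) \<in> parcs (Gamma12 m r s)"
  shows "\<exists>w q. (gu m 0, w) \<in> parcs (Gamma12 m r s) \<and>
    opposite (\<lambda>x y. (x, y) \<in> parcs (Gamma12 m r s)) y (gu m 0) w q"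
proof -
  let ?E = "\<lambda>x y. (x, y) \<in> parcs (Gamma12 m r s)"
  have m: "m \<noteq> 0" "\<not> 2 * m dvd m" using assms(1) by simp_all
  note arcs = Gamma12_arcs[OF assms(1)] gamma_vertex_eq_iff m
  have 1: "opposite ?E (gv m 0) (gu m 0) (ga m 0) (gv m m)"
    unfolding opposite_def
    by (rule exI[of _ "gb m 0"], rule exI[of _ "gu m m"]) (simp add: arcs)
  have 2: "opposite ?E (gv m r) (gu m 0) (ga m 0) (gv m (r + m))"
    unfolding opposite_def
    by (rule exI[of _ "gb m r"], rule exI[of _ "gu m m"]) (simp add: arcs algebra_simps)
  from assms consider "y = gv m 0" | "y = gv m r" | "y = ga m 0" by (auto simp: arcs)
  then show ?thesis
    using 1 2 opposite_commute[THEN iffD1, OF 1]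
    by cases (auto simp: arcs(1))
qed

text \<open>The other four vertices must alternate between \<open>v\<close> and \<open>u\<close>;
  adding the index changes around the cycle gives \<open>s\<close> modulo \<open>m\<close>.\<close>

lemma Gamma12_hexagon_through_ab:
  assumes "m > 0" "(ga m 0, w) \<in> parcs (Gamma12 m r s)"
    and "opposite (\<lambda>x y. (x, y) \<in> parcs (Gamma12 m r s)) (gb m s) (ga m 0) w q"
  shows "m dvd s + r \<or> m dvd s - 2 * r"
proof -
  note arcs = Gamma12_arcs[OF assms(1)]
  obtain y z where *: "(gb m s, y) \<in> parcs (Gamma12 m r s)" "(y, q) \<in> parcs (Gamma12 m r s)"
      "(w, z) \<in> parcs (Gamma12 m r s)" "(z, q) \<in> parcs (Gamma12 m r s)"
      and dist: "distinct [ga m 0, gb m s, y, q, z, w]"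
    using assms(3) unfolding opposite_def by blast
  obtain d where d: "w = gu m d" "m dvd d"
    using assms(2) dist by (auto simp: arcs)
  obtain e where e: "y = gv m e" "m dvd e - s"
    using *(1) dist by (auto simp: arcs)
  have "gb m e = gb m s" using e(2) by (simp add: gamma_vertex_eq_iff)
  then have "q = gu m (e - 0) \<or> q = gu m (e - r)"
    using *(2) dist by (auto simp: arcs e(1))
  then obtain \<alpha> where \<alpha>: "q = gu m (e - \<alpha>)" "\<alpha> = 0 \<or> \<alpha> = r" by blast
  have "ga m d = ga m 0" using d(2) by (simp add: gamma_vertex_eq_iff)
  then have "z = gv m (d + 0) \<or> z = gv m (d + r)"
    using *(3) dist by (auto simp: arcs d(1))
  then obtain \<beta> where \<beta>: "z = gv m (d + \<beta>)" "\<beta> = 0 \<or> \<beta> = r" by blast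
  have "q = gu m (d + \<beta> - 0) \<or> q = gu m (d + \<beta> - r)"
    using *(4) by (auto simp: arcs \<alpha>(1) \<beta>(1))
  then obtain \<gamma> where "q = gu m (d + \<beta> - \<gamma>)" and \<gamma>': "\<gamma> = 0 \<or> \<gamma> = r" by blast
  then have "gu m (e - \<alpha>) = gu m (d + \<beta> - \<gamma>)" using \<alpha>(1) by simp
  then have \<gamma>: "2 * m dvd (e - \<alpha>) - (d + \<beta> - \<gamma>)" by (simp only: gamma_vertex_eq_iff)
  \<comment> \<open>From \<open>q \<noteq> w\<close> and \<open>y \<noteq> z\<close> follow \<gamma>
    \<noteq> \<beta> and \<gamma> \<noteq> \<alpha>, which leaves \<alpha> = \<beta> with \<gamma>
    the other value.\<close>
  have "\<not> 2 * m dvd e - \<alpha> - d" "\<not> 2 * m dvd e - (d + \<beta>)"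
    using dist by (auto simp: d(1) e(1) \<alpha>(1) \<beta>(1) gamma_vertex_eq_iff)
  with \<gamma> \<gamma>' \<alpha>(2) \<beta>(2)
  have "\<gamma> - \<alpha> - \<beta> = r \<or> \<gamma> - \<alpha> - \<beta> = - 2 * r"
    by (auto simp: algebra_simps)
  moreover have "m dvd s + (\<gamma> - \<alpha> - \<beta>)"
  proof -
    have "m dvd (e - \<alpha>) - (d + \<beta> - \<gamma>)" using \<gamma> dvd_mult_right by blast
    with d(2) e(2) have "m dvd ((e - \<alpha>) - (d + \<beta> - \<gamma>)) - (e - s) + d"
      by (blast intro: dvd_add dvd_diff)
    also have "\<dots> = s + (\<gamma> - \<alpha> - \<beta>)" by simp
    finally show ?thesis .
  qed
  ultimately show ?thesis by auto
qed

text \<open>An automorphism taking \<open>u\<close> with index 0 to \<open>a\<close> with index 0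
  carries a hexagon to the edge from \<open>a\<close> to \<open>b\<close>.\<close>

lemma Gamma12_vertex_transitive_imp:
  assumes "m > 0" "vertex_transitive (Gamma12 m r s)"
  shows "m dvd s + r \<or> m dvd s - 2 * r"
proof -
  let ?G = "Gamma12 m r s"
  let ?E = "\<lambda>x y. (x, y) \<in> parcs ?G"
  interpret pair_graph ?G using assms(1) by (rule pair_graph_Gamma12)
  have V: "gu m 0 \<in> pverts ?G" "ga m 0 \<in> pverts ?G" "gb m s \<in> pverts ?G"
    by (simp_all add: pverts_Gamma12[OF assms(1)])
  obtain f where f: "f \<in> carrier (Aut ?G)" "f (gu m 0) = ga m 0"
    using assms(2) V unfolding vertex_transitive_def by blast
  have inj: "inj_on f (pverts ?G)" and surj: "f ` pverts ?G = pverts ?G"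
    and arc: "\<And>x y. x \<in> pverts ?G \<Longrightarrow> y \<in> pverts ?G \<Longrightarrow> ?E x y \<longleftrightarrow> ?E (f x) (f y)"
    using f(1) by (auto simp: Aut_def Bij_def bij_betw_def)
  obtain y where y: "y \<in> pverts ?G" "f y = gb m s" using surj V(3) by (metis imageE)
  have "?E (ga m 0) (gb m s)" by (simp add: Gamma12_arcs[OF assms(1)])
  then have "?E (gu m 0) y" using arc[OF V(1) y(1)] f(2) y(2) by simp
  then obtain w q where wq: "?E (gu m 0) w" "opposite ?E y (gu m 0) w q"
    using Gamma12_u_edges_on_hexagons[OF assms(1)] by blast
  have "?E (ga m 0) (f w)" using arc[OF V(1) in_arcsD2[OF wq(1)]] wq(1) f(2) by simp
  moreover have "opposite ?E (gb m s) (ga m 0) (f w) (f q)"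
  proof -
    have "y \<in> pverts ?G \<and> ?E (f x) (f y)" if "x \<in> pverts ?G" "?E x y" for x y
      using that arc[OF that(1) in_arcsD2[OF that(2)]] in_arcsD2[OF that(2)] by simp
    from opposite_image[where E = ?E and E' = ?E, OF inj this y(1) V(1) in_arcsD2[OF wq(1)] wq(2)]
    show ?thesis unfolding f(2) y(2) by blast
  qed
  ultimately show ?thesis by (rule Gamma12_hexagon_through_ab[OF assms(1)])
qed

text \<open>Along an edge the index changes by a combination of \<open>r\<close>, \<open>s\<close>
  and \<open>m\<close>, all divisible by \<open>g\<close>. Its residue modulo \<open>g\<close> is
  therefore constant, and comparing indices 0 and 1 gives \<open>g = 1\<close>.\<close>

lemma Gamma12_connected_imp_coprime:
  assumes "m > 0" "Digraph_Component.connected (Gamma12 m r s)"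
    and s: "m dvd s + r \<or> m dvd s - 2 * r"
  shows "coprime r m"
proof -
  let ?G = "Gamma12 m r s"
  define g where "g = gcd r m"
  define c where "c = (\<lambda>x. case x of U i \<Rightarrow> i mod g | V i \<Rightarrow> i mod g | A i \<Rightarrow> i mod g | B i \<Rightarrow> i mod g)"
  have g: "g dvd r" "g dvd m" by (simp_all add: g_def)
  have gs: "g dvd s"
  proof (use s in \<open>elim disjE\<close>)
    assume "m dvd s + r"
    then have "g dvd s + r" using g(2) dvd_trans by blast
    then show ?thesis using g(1) by (simp add: dvd_add_left_iff)
  next
    assume "m dvd s - 2 * r"
    then have "g dvd (s - 2 * r) + 2 * r" using g dvd_trans by (intro dvd_add) auto
    then show ?thesis by simp
  qed
  have c: "c (gu m i) = i mod g" "c (gv m i) = i mod g" "c (ga m i) = i mod g" "c (gb m i) = i mod g" for i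
    using g by (simp_all add: c_def gamma_vertex_defs mod_mod_cancel)
  have shift: "(i + r) mod g = i mod g" "(i - r) mod g = i mod g" "(i + m) mod g = i mod g"
    "(i + s) mod g = i mod g" "(i - s) mod g = i mod g" for i
    using g gs by (simp_all add: mod_eq_dvd_iff)
  interpret pair_graph ?G using assms(1) by (rule pair_graph_Gamma12)
  have "c (gu m 0) = c (gu m 1)"
  proof (rule connected_constant[OF pair_graph_Gamma12[OF assms(1)] assms(2)])
    fix x y assume xy: "(x, y) \<in> parcs ?G"
    then have "x \<in> pverts ?G" by (rule in_arcsD1)
    with xy show "c x = c y"
      unfolding pverts_Gamma12[OF assms(1)]
      by (auto simp: Gamma12_arcs[OF assms(1)] c shift)
  qed (simp_all add: pverts_Gamma12[OF assms(1)])
  then have "0 mod g = 1 mod g" by (simp only: c)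
  then have "g dvd 0 - 1" by (simp only: mod_eq_dvd_iff)
  then have "g dvd 1" by simp
  then show ?thesis by (simp add: g_def coprime_iff_gcd_eq_1)
qed

section \<open>\<open>Gamma12\<close> as a necklace of hexagons\<close>

text \<open>The two cases for \<open>\<sigma>\<close> are \<open>s \<equiv> 2r\<close> and \<open>s \<equiv> -r\<close>.\<close>

lemma necklace_Gamma12:
  fixes m r s \<rho> \<sigma> :: int
  defines "u \<equiv> \<lambda>k l. gu m (k * \<rho> + l * m)" and "v \<equiv> \<lambda>k l. gv m (\<sigma> + k * \<rho> + l * m)"
    and "a \<equiv> \<lambda>k. ga m (k * \<rho>)" and "b \<equiv> \<lambda>k. gb m (\<sigma> + k * \<rho>)"
  assumes m: "m > 3" and cop: "coprime \<rho> m"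
    and \<sigma>: "\<rho> = r \<and> \<sigma> = 0 \<or> \<rho> = - r \<and> \<sigma> = r" and s: "m dvd s - \<sigma> - 2 * \<rho>"
  shows "hexagon_necklace (\<lambda>x y. (x, y) \<in> parcs (Gamma12 m r s)) u v a b m \<rho>"
    and "hexagon_necklace.vertices u v a b = pverts (Gamma12 m r s)"
proof -
  have m0: "m > 0" using m by simp
  note arcs = Gamma12_arcs[OF m0]
  have dvd: "m dvd (k - k') * \<rho> \<longleftrightarrow> m dvd k - k'" for k k'
    using cop by (simp add: coprime_commute coprime_dvd_mult_left_iff)
  show *: "hexagon_necklace (\<lambda>x y. (x, y) \<in> parcs (Gamma12 m r s)) u v a b m \<rho>"
  proof
    fix k k' l l' :: int and y
    show "u k l = u k' l' \<longleftrightarrow> 2 * m dvd (k - k') * \<rho> + (l - l') * m"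
      "v k l = v k' l' \<longleftrightarrow> 2 * m dvd (k - k') * \<rho> + (l - l') * m"
      by (simp_all add: u_def v_def gamma_vertex_eq_iff algebra_simps)
    show "a k = a k' \<longleftrightarrow> m dvd k - k'" "b k = b k' \<longleftrightarrow> m dvd k - k'"
      using dvd[of k k'] by (simp_all add: a_def b_def gamma_vertex_eq_iff algebra_simps)
    have al: "ga m (k * \<rho> + l * m) = ga m (k * \<rho>)" "gb m (\<sigma> + k * \<rho> + l * m) = gb m (\<sigma> + k * \<rho>)"
      by (simp_all add: gamma_vertex_eq_iff)
    \<comment> \<open>For \<rho> = \<open>- r\<close> and \<sigma> = \<open>r\<close> the two
      \<open>v\<close> neighbours exchange roles: the one with equal index is
      \<open>v (k + 1) l\<close>.\<close>
    show "((u k l, y) \<in> parcs (Gamma12 m r s)) \<longleftrightarrow> y = v k l \<or> y = v (k + 1) l \<or> y = a k"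
      unfolding u_def v_def a_def arcs al using \<sigma> by (auto simp: algebra_simps)
    show "((v k l, y) \<in> parcs (Gamma12 m r s)) \<longleftrightarrow> y = u k l \<or> y = u (k - 1) l \<or> y = b k"
      unfolding u_def v_def b_def arcs al using \<sigma> by (auto simp: algebra_simps)
    have "gb m (k * \<rho> + s) = gb m (\<sigma> + (k + 2) * \<rho>)" "ga m (\<sigma> + k * \<rho> - s) = ga m ((k - 2) * \<rho>)"
      using s dvd_diff_commute[of m "\<sigma> + 2 * \<rho>" s] by (simp_all add: gamma_vertex_eq_iff algebra_simps)
    then show "((a k, y) \<in> parcs (Gamma12 m r s)) \<longleftrightarrow> y = u k 0 \<or> y = u k 1 \<or> y = b (k + 2)"
      "((b k, y) \<in> parcs (Gamma12 m r s)) \<longleftrightarrow> y = v k 0 \<or> y = v k 1 \<or> y = a (k - 2)"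
      by (simp_all add: u_def v_def a_def b_def arcs)
  qed (use m cop in \<open>simp_all add: u_def v_def a_def b_def\<close>)
  \<comment> \<open>Bezout's identity makes the coordinates reach every index.\<close>
  have ex: "\<exists>k l. i = k * \<rho> + l * m" for i
  proof -
    obtain x y where "x * \<rho> + y * m = 1" using cop bezout_int[of \<rho> m] by auto
    then have "i = (i * x) * \<rho> + (i * y) * m" by (metis distrib_left mult.assoc mult.right_neutral)
    then show ?thesis by blast
  qed
  have ex': "\<exists>k l. i = \<sigma> + k * \<rho> + l * m" for i
    using ex[of "i - \<sigma>"] by (auto simp: algebra_simps)
  have rng: "range (case_prod F) = range C"
    if "\<And>k l. F k l \<in> range C" and cover: "\<And>i. \<exists>k l. C i = F k l"
    for F :: "int \<Rightarrow> int \<Rightarrow> gamma_vertex" and C :: "int \<Rightarrow> gamma_vertex"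
  proof
    show "range (case_prod F) \<subseteq> range C" using that(1) by auto
    show "range C \<subseteq> range (case_prod F)"
    proof
      fix x assume "x \<in> range C"
      then obtain i where "x = C i" by blast
      moreover obtain k l where "C i = F k l" using cover by blast
      ultimately have "x = case_prod F (k, l)" by simp
      then show "x \<in> range (case_prod F)" by (simp only: rangeI)
    qed
  qed
  have "range (case_prod u) = range (gu m)"
  proof (rule rng)
    show "\<exists>k l. gu m i = u k l" for i
      using ex[of i] unfolding u_def by metis
  qed (simp add: u_def)
  moreover have "range (case_prod v) = range (gv m)"
  proof (rule rng)
    show "\<exists>k l. gv m i = v k l" for i
      using ex'[of i] unfolding v_def by metis
  qed (simp add: v_def)
  moreover have "range a = range (ga m)"
  proof
    have "\<exists>k. ga m i = a k" for i
    proof -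
      obtain k l where "i = k * \<rho> + l * m" using ex by blast
      then have "ga m i = a k" by (simp add: a_def gamma_vertex_eq_iff)
      then show ?thesis ..
    qed
    then show "range (ga m) \<subseteq> range a" by auto
  qed (auto simp: a_def)
  moreover have "range b = range (gb m)"
  proof
    have "\<exists>k. gb m i = b k" for i
    proof -
      obtain k l where "i = \<sigma> + k * \<rho> + l * m" using ex' by blast
      then have "gb m i = b k" by (simp add: b_def gamma_vertex_eq_iff)
      then show ?thesis ..
    qed
    then show "range (gb m) \<subseteq> range b" by auto
  qed (auto simp: b_def)
  ultimately show "hexagon_necklace.vertices u v a b = pverts (Gamma12 m r s)"
    by (simp add: hexagon_necklace.vertices_def[OF *] pverts_Gamma12[OF m0])
qed

lemma Gamma12_vertex_transitive_imp_odd: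
  assumes m: "m > 3" and cop: "coprime \<rho> m"
    and \<sigma>: "\<rho> = r \<and> \<sigma> = 0 \<or> \<rho> = - r \<and> \<sigma> = r" and s: "m dvd s - \<sigma> - 2 * \<rho>"
    and vt: "vertex_transitive (Gamma12 m r s)"
  shows "odd m \<and> odd \<rho>"
proof -
  let ?G = "Gamma12 m r s"
  interpret G: pair_graph ?G using m by (intro pair_graph_Gamma12) simp
  interpret hexagon_necklace "\<lambda>x y. (x, y) \<in> parcs ?G" "\<lambda>k l. gu m (k * \<rho> + l * m)"
      "\<lambda>k l. gv m (\<sigma> + k * \<rho> + l * m)" "\<lambda>k. ga m (k * \<rho>)" "\<lambda>k. gb m (\<sigma> + k * \<rho>)" m \<rho>
    by (rule necklace_Gamma12[OF m cop \<sigma> s])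
  have V: "vertices = pverts ?G" by (rule necklace_Gamma12[OF m cop \<sigma> s])
  have "gu m 0 \<in> pverts ?G" "ga m 0 \<in> pverts ?G"
    using m by (simp_all add: pverts_Gamma12)
  then obtain f where f: "f \<in> carrier (Aut ?G)" "f (ga m 0) = gu m 0"
    using vt unfolding vertex_transitive_def by blast
  have inj: "inj_on f (pverts ?G)" and surj: "f ` pverts ?G = pverts ?G"
    and arc: "\<And>x y. x \<in> pverts ?G \<Longrightarrow> y \<in> pverts ?G \<Longrightarrow> (x, y) \<in> parcs ?G \<longleftrightarrow> (f x, f y) \<in> parcs ?G"
    using f(1) by (auto simp: Aut_def Bij_def bij_betw_def)
  interpret necklace_endo "\<lambda>x y. (x, y) \<in> parcs ?G" "\<lambda>k l. gu m (k * \<rho> + l * m)"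
      "\<lambda>k l. gv m (\<sigma> + k * \<rho> + l * m)" "\<lambda>k. ga m (k * \<rho>)" "\<lambda>k. gb m (\<sigma> + k * \<rho>)" m \<rho> f
  proof
    show "inj_on f vertices" using inj V by simp
    show "f x \<in> vertices" if "x \<in> vertices" for x using that surj V by auto
    show "(f x, f y) \<in> parcs ?G" if "(x, y) \<in> parcs ?G" for x y
      using that arc[OF G.in_arcsD1[OF that] G.in_arcsD2[OF that]] by simp
  qed
  show ?thesis by (rule odd_if_maps_a_to_u) (simp add: f(2))
qed

lemma Gamma12_iso_SDW:
  assumes m: "m > 3" and cop: "coprime \<rho> m"
    and \<sigma>: "\<rho> = r \<and> \<sigma> = 0 \<or> \<rho> = - r \<and> \<sigma> = r" and s: "m dvd s - \<sigma> - 2 * \<rho>"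
    and odd: "odd m" "odd \<rho>"
  shows "digraph_iso (SDW m 3) (Gamma12 m r s)"
proof -
  let ?G = "Gamma12 m r s"
  interpret hexagon_necklace "\<lambda>x y. (x, y) \<in> parcs ?G" "\<lambda>k l. gu m (k * \<rho> + l * m)"
      "\<lambda>k l. gv m (\<sigma> + k * \<rho> + l * m)" "\<lambda>k. ga m (k * \<rho>)" "\<lambda>k. gb m (\<sigma> + k * \<rho>)" m \<rho>
    by (rule necklace_Gamma12[OF m cop \<sigma> s])
  have V: "vertices = pverts ?G" by (rule necklace_Gamma12[OF m cop \<sigma> s])
  have "pair_graph ?G" using m by (intro pair_graph_Gamma12) simp
  then show ?thesis by (intro digraph_iso_SDW odd) (simp_all add: V)
qed

section \<open>Classification of connected vertex-transitive \<open>Gamma12\<close> graphs and its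
  converse\<close>

theorem theorem6p12:
  fixes m r s :: int
  assumes "m > 3" and "r > 0" and "s > 0"
    and "\<not> [r = 0] (mod (2 * m))"
  shows "(Digraph_Component.connected (Gamma12 m r s) \<and> vertex_transitive (Gamma12 m r s)
            \<longrightarrow> odd m \<and> digraph_iso (Gamma12 m r s) (SDW m 3))
       \<and> (odd m \<longrightarrow>
            digraph_iso (SDW m 3) (Gamma12 m 1 2)
            \<and> Digraph_Component.connected (SDW m 3)
            \<and> vertex_transitive (SDW m 3)
            \<and> (\<exists>f \<in> carrier (Aut (SDW m 3)). int (group.ord (Aut (SDW m 3)) f) = 2 * m))"
proof (intro conjI impI; (elim conjE)?)
  assume con: "Digraph_Component.connected (Gamma12 m r s)" and vt: "vertex_transitive (Gamma12 m r s)"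
  have m0: "m > 0" using assms(1) by simp
  have s: "m dvd s + r \<or> m dvd s - 2 * r" by (rule Gamma12_vertex_transitive_imp[OF m0 vt])
  have cop: "coprime r m" by (rule Gamma12_connected_imp_coprime[OF m0 con s])
  obtain \<rho> \<sigma> where \<rho>: "\<rho> = r \<and> \<sigma> = 0 \<or> \<rho> = - r \<and> \<sigma> = r" "m dvd s - \<sigma> - 2 * \<rho>"
    using s
  proof
    assume "m dvd s + r"
    then show ?thesis using that[of "- r" r] by (simp add: add.commute)
  next
    assume "m dvd s - 2 * r"
    then show ?thesis using that[of r 0] by simp
  qed
  have cop': "coprime \<rho> m" using cop \<rho>(1) by auto
  have odd: "odd m" "odd \<rho>"
    using Gamma12_vertex_transitive_imp_odd[OF assms(1) cop' \<rho> vt] by auto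
  then show "odd m" by simp
  have "digraph_iso (SDW m 3) (Gamma12 m r s)"
    by (rule Gamma12_iso_SDW[OF assms(1) cop' \<rho> odd])
  moreover interpret S: pair_graph "SDW m 3" using m0 by (simp add: pair_graph_SDW)
  have "wf_digraph (with_proj (SDW m 3))" by (rule S.wf_digraph_axioms)
  ultimately show "digraph_iso (Gamma12 m r s) (SDW m 3)"
    by (blast intro: digraph_iso_swap)
next
  assume odd: "odd m"
  have m0: "m > 0" using assms(1) by simp
  \<comment> \<open>Here \<rho> = \<open>r\<close> = 1 and \<sigma> = 0, with \<open>s\<close> equal
    to \<open>2 * r\<close>.\<close>
  show "digraph_iso (SDW m 3) (Gamma12 m 1 2)"
    by (rule Gamma12_iso_SDW[of m 1 1 0]) (use assms(1) odd in auto)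
  show "Digraph_Component.connected (SDW m 3)" by (rule connected_SDW[OF m0])
  show "vertex_transitive (SDW m 3)" using m0 by (intro vertex_transitive_SDW) auto
  show "\<exists>f \<in> carrier (Aut (SDW m 3)). int (group.ord (Aut (SDW m 3)) f) = 2 * m"
    using SDW_aut_order[OF m0 odd] SDW_aut_in_Aut[OF m0, of 3 1 "- 1" 1 0] by auto
qed

end
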